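(* Let $U=(\rho_1,\dots,\rho_n,v,\theta)$ be a smooth solution (with $\rho_i,\theta>0$) of $$\partial_t\rho_i+\mathrm{div}(\rho_iv)=-\mathrm{div}(\rho_iu_i)\ (i=1,\dots,n),\qquad \partial_t(\rho v)+\mathrm{div}(\rho v\otimes v+p\,\mathbb I)=0,$$ $$\partial_t\big(\rho e+\tfrac12\rho|v|^2\big)+\mathrm{div}\big((\rho e+\tfrac12\rho|v|^2)v+pv\big)=\mathrm{div}\Big(\kappa\nabla\theta-\sum_jh_ju_j\Big),$$ where $u_1,\dots,u_n$ are determined by $$-\sum_{j\neq i}b_{ij}\theta\rho_i\rho_j(u_i-u_j)=\epsilon d_i,\qquad \sum_i\rho_iu_i=0,\qquad d_i:=-\frac{\rho_i}{\rho}\nabla p+\rho_i\theta\nabla\frac{\mu_i}{\theta}-\theta h_i\nabla\frac1\theta ,$$ and let $\bar U=(\bar\rho_1,\dots,\bar\rho_n,\bar v,\bar\theta)$ be a smooth solution (with $\bar\rho_i,\bar\theta>0$) of $$\partial_t\bar\rho_i+\mathrm{div}(\bar\rho_i\bar v)=0\ (i=1,\dots,n),\qquad \partial_t(\bar\rho\bar v)+\mathrm{div}(\bar\rho\bar v\otimes\bar v+\bar p\,\mathbb I)=0,$$ $$\partial_t\big(\bar\rho\bar e+\tfrac12\bar\rho|\bar v|^2\big)+\mathrm{div}\big((\bar\rho\bar e+\tfrac12\bar\rho|\bar v|^2)\bar v+\bar p\bar v\big)=\mathrm{div}(\bar\kappa\nabla\bar\theta).$$ Then $$\begin{aligned} &\partial_tI(U|\bar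 U)+\mathrm{div}\Big[vI(U|\bar U)+(p-\bar p)(v-\bar v)+\sum_j\rho_ju_j(\mu_j-\bar\mu_j)\\ &\quad-(\theta-\bar\theta)\Big(\frac1\theta\kappa\nabla\theta-\frac1{\bar\theta}\bar\kappa\nabla\bar\theta\Big)+\frac1\theta(\theta-\bar\theta)\sum_j(h_j-\rho_j\mu_j)u_j\Big]+\bar\theta\kappa\Big|\frac{\nabla\theta}{\theta}-\frac{\nabla\bar\theta}{\bar\theta}\Big|^2-\frac{\bar\theta}{\theta}\sum_ju_j\cdot d_j\\ &=(\partial_t\bar\theta+\bar v\cdot\nabla\bar\theta)(-\rho\eta)(\omega|\bar\omega)-p(\omega|\bar\omega)\,\mathrm{div}\,\bar v-(\eta-\bar\eta)\rho(v-\bar v)\cdot\nabla\bar\theta\\ &\quad-\sum_j\Big(\frac{\rho_j}{\rho}-\frac{\bar\rho_j}{\bar\rho}\Big)\nabla\bar\mu_j\cdot\rho(v-\bar v)-\rho(v-\bar v)\nabla\bar v\cdot(v-\bar v)-\sum_j\nabla\bar\mu_j\cdot\rho_ju_j\\ &\quad-\Big(\frac{\nabla\theta}{\theta}-\frac{\nabla\bar\theta}{\bar\theta}\Big)\cdot\frac{\nabla\bar\theta}{\bar\theta}(\bar\theta\kappa-\theta\bar\kappa)-\frac1{\bar\theta}\nabla\bar\theta\cdot\sum_j(h_j-\rho_j\mu_j)u_j . \end{aligned}$$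
   Context: The fluid has $n$ components with mass densities $\rho_i$, common velocity $v\in\mathbb R^3$, common temperature $\theta$, and total mass $\rho=\sum_i\rho_i$; $\omega=(\rho_1,\dots,\rho_n,\theta)$ and $\bar\omega=(\bar\rho_1,\dots,\bar\rho_n,\bar\theta)$, $\bar\rho=\sum_i\bar\rho_i$. The vectors $u_i$ are the diffusional velocities of the components. Thermodynamics: the Helmholtz free energy $\rho\psi=\rho\psi(\rho_1,\dots,\rho_n,\theta)$ is given (smooth), and the entropy $\rho\eta$, internal energy $\rho e$, chemical potentials $\mu_i$ and total pressure $p$ are determined by $$(\rho\psi)_\theta=-\rho\eta,\quad \rho\psi=\rho e-\rho\eta\theta,\quad (\rho\psi)_{\rho_i}=\mu_i,\quad \rho\psi+p=\sum_i\rho_i\mu_i .$$ The partial internal energies $e_i$ and partial pressures $p_i$ are given constitutive functions of $(\rho_1,\dots,\rho_n,\theta)$ with $\sum_i\rho_ie_i=\rho e$ and $\sum_ip_i=p$, and $h_i:=\rho_ie_i+p_i$. The heat conductivity $\kappa=\kappa(\rho_1,\dots,\rho_n,\theta)\ge0$ is a given function; $b_{ij}=b_{ij}(\rho_i,\rho_j,\theta)$ are symmetric, strictly positive; $\epsilon>0$. A bar over a thermodynamic function (including $\kappa$) means that it is evaluated at $\bar\omega$; unbarred ones are evaluated at $\omega$. The relative quantities are $$I(U|\bar U)=\tfrac12\rho|v-\bar v|^2+\rho e-\bar\rho\bar e-\sum_i\bar\mu_i(\rho_i-\bar\rho_i)-\bar\theta(\rho\eta-\bar\rho\bar\eta),$$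 $$p(\omega|\bar\omega)=p-\bar p-\sum_j\bar p_{\rho_j}(\rho_j-\bar\rho_j)-\bar p_\theta(\theta-\bar\theta),$$ $$(-\rho\eta)(\omega|\bar\omega)=-\rho\eta+\bar\rho\bar\eta+\sum_j(\bar\rho\bar\eta)_{\rho_j}(\rho_j-\bar\rho_j)+(\bar\rho\bar\eta)_\theta(\theta-\bar\theta).$$ Subscripts $\rho_j,\theta$ denote partial derivatives in the variables $(\rho_1,\dots,\rho_n,\theta)$, and $w\nabla\bar v\cdot w=\sum_{\alpha,\beta}w_\alpha w_\beta\,\partial_{x_\alpha}\bar v_\beta$.
   Formalization: The last term of the identity is proved with coefficient 1/θ instead of the printed 1/θ̄, i.e. −(1/θ)∇θ̄·Σ_j(h_j−ρ_jμ_j)u_j; with 1/θ̄ the identity is false (a two-component ideal gas is a counterexample). *)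

theory Defs
  imports "HOL-Analysis.Analysis"
begin

(* C^k and C^infinity on an open set, by iterating directional derivatives. *)

primrec Ck_on :: "nat \<Rightarrow> ('a::real_normed_vector \<Rightarrow> 'b::real_normed_vector) \<Rightarrow> 'a set \<Rightarrow> bool" where
  "Ck_on 0 f S = continuous_on S f"
| "Ck_on (Suc k) f S =
     ((\<forall>x\<in>S. f differentiable (at x)) \<and> (\<forall>w. Ck_on k (\<lambda>x. frechet_derivative f (at x) w) S))"

definition smooth_on :: "('a::real_normed_vector \<Rightarrow> 'b::real_normed_vector) \<Rightarrow> 'a set \<Rightarrow> bool" where
  "smooth_on f S \<longleftrightarrow> (\<forall>k. Ck_on k f S)"


(* Space-time points are pairs (t, x). *)

type_synonym spacetime = "real \<times> (real^3)"

definition dt :: "(spacetime \<Rightarrow> 'a::real_normed_vector) \<Rightarrow> spacetime \<Rightarrow> 'a" where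
  "dt f z = vector_derivative (\<lambda>s. f (s, snd z)) (at (fst z))"

definition dx :: "3 \<Rightarrow> (spacetime \<Rightarrow> real) \<Rightarrow> spacetime \<Rightarrow> real" where
  "dx \<alpha> f z = deriv (\<lambda>s. f (fst z, snd z + s *\<^sub>R axis \<alpha> 1)) 0"

definition grad :: "(spacetime \<Rightarrow> real) \<Rightarrow> spacetime \<Rightarrow> real^3" where
  "grad f z = (\<chi> \<alpha>. dx \<alpha> f z)"

definition divg :: "(spacetime \<Rightarrow> real^3) \<Rightarrow> spacetime \<Rightarrow> real" where
  "divg F z = (\<Sum>\<alpha>\<in>UNIV. dx \<alpha> (\<lambda>y. F y $ \<alpha>) z)"

definition div_tensor :: "(spacetime \<Rightarrow> real^3^3) \<Rightarrow> spacetime \<Rightarrow> real^3" where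
  "div_tensor T z = (\<chi> \<beta>. \<Sum>\<alpha>\<in>UNIV. dx \<alpha> (\<lambda>y. T y $ \<alpha> $ \<beta>) z)"

definition outer :: "real^3 \<Rightarrow> real^3 \<Rightarrow> real^3^3" where
  "outer v w = (\<chi> \<alpha> \<beta>. v $ \<alpha> * w $ \<beta>)"

definition grad_quad :: "real^3 \<Rightarrow> (spacetime \<Rightarrow> real^3) \<Rightarrow> spacetime \<Rightarrow> real" where
  "grad_quad w v z = (\<Sum>\<alpha>\<in>UNIV. \<Sum>\<beta>\<in>UNIV. w $ \<alpha> * w $ \<beta> * dx \<alpha> (\<lambda>y. v y $ \<beta>) z)"


(* A thermodynamic state is a pair ((rho_1, ..., rho_n), theta), with n = CARD('n). *)

type_synonym 'n state = "(real^'n) \<times> real"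

definition states :: "('n::finite) state set" where
  "states = {\<omega>. (\<forall>i. 0 < fst \<omega> $ i) \<and> 0 < snd \<omega>}"

definition total_mass :: "('n::finite) state \<Rightarrow> real" where
  "total_mass \<omega> = (\<Sum>i\<in>UNIV. fst \<omega> $ i)"

definition d_rho :: "'n::finite \<Rightarrow> ('n state \<Rightarrow> real) \<Rightarrow> 'n state \<Rightarrow> real" where
  "d_rho j F \<omega> = deriv (\<lambda>s. F (fst \<omega> + s *\<^sub>R axis j 1, snd \<omega>)) 0"

definition d_theta :: "(('n::finite) state \<Rightarrow> real) \<Rightarrow> 'n state \<Rightarrow> real" where
  "d_theta F \<omega> = deriv (\<lambda>s. F (fst \<omega>, s)) (snd \<omega>)"

(* F is the Helmholtz free energy density rho psi; the next definitions give the densities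
   rho eta and rho e, then eta, mu_i and p. *)

definition entropy_dens :: "(('n::finite) state \<Rightarrow> real) \<Rightarrow> 'n state \<Rightarrow> real" where
  "entropy_dens F \<omega> = - d_theta F \<omega>"

definition energy_dens :: "(('n::finite) state \<Rightarrow> real) \<Rightarrow> 'n state \<Rightarrow> real" where
  "energy_dens F \<omega> = F \<omega> + entropy_dens F \<omega> * snd \<omega>"

definition entropy :: "(('n::finite) state \<Rightarrow> real) \<Rightarrow> 'n state \<Rightarrow> real" where
  "entropy F \<omega> = entropy_dens F \<omega> / total_mass \<omega>"

definition chem_pot :: "(('n::finite) state \<Rightarrow> real) \<Rightarrow> 'n \<Rightarrow> 'n state \<Rightarrow> real" where
  "chem_pot F i \<omega> = d_rho i F \<omega>"

definition pressure :: "(('n::finite) state \<Rightarrow> real) \<Rightarrow> 'n state \<Rightarrow> real" where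
  "pressure F \<omega> = (\<Sum>i\<in>UNIV. fst \<omega> $ i * chem_pot F i \<omega>) - F \<omega>"

(* e i and q i are the partial internal energy e_i and the partial pressure p_i. *)

definition enthalpy ::
  "('n::finite \<Rightarrow> 'n state \<Rightarrow> real) \<Rightarrow> ('n \<Rightarrow> 'n state \<Rightarrow> real) \<Rightarrow> 'n \<Rightarrow> 'n state \<Rightarrow> real" where
  "enthalpy e q i \<omega> = fst \<omega> $ i * e i \<omega> + q i \<omega>"


definition rel_energy ::
  "(('n::finite) state \<Rightarrow> real) \<Rightarrow> 'n state \<Rightarrow> real^3 \<Rightarrow> 'n state \<Rightarrow> real^3 \<Rightarrow> real" where
  "rel_energy F \<omega> v \<omega>' v' =
     1/2 * total_mass \<omega> * (norm (v - v'))\<^sup>2 + energy_dens F \<omega> - energy_dens F \<omega>'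
     - (\<Sum>i\<in>UNIV. chem_pot F i \<omega>' * (fst \<omega> $ i - fst \<omega>' $ i))
     - snd \<omega>' * (entropy_dens F \<omega> - entropy_dens F \<omega>')"

definition rel_pressure :: "(('n::finite) state \<Rightarrow> real) \<Rightarrow> 'n state \<Rightarrow> 'n state \<Rightarrow> real" where
  "rel_pressure F \<omega> \<omega>' =
     pressure F \<omega> - pressure F \<omega>'
     - (\<Sum>j\<in>UNIV. d_rho j (pressure F) \<omega>' * (fst \<omega> $ j - fst \<omega>' $ j))
     - d_theta (pressure F) \<omega>' * (snd \<omega> - snd \<omega>')"

definition rel_neg_entropy :: "(('n::finite) state \<Rightarrow> real) \<Rightarrow> 'n state \<Rightarrow> 'n state \<Rightarrow> real" where
  "rel_neg_entropy F \<omega> \<omega>' =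
     - entropy_dens F \<omega> + entropy_dens F \<omega>'
     + (\<Sum>j\<in>UNIV. d_rho j (entropy_dens F) \<omega>' * (fst \<omega> $ j - fst \<omega>' $ j))
     + d_theta (entropy_dens F) \<omega>' * (snd \<omega> - snd \<omega>')"


(* The constitutive functions are smooth on the set of positive states. The coefficient b_ij
   depends on (rho_i, rho_j, theta) only, so symmetry of the matrix (b_ij) swaps the first two
   arguments; only i \<noteq> j occurs in the equations. *)

definition constitutive ::
  "(('n::finite) state \<Rightarrow> real) \<Rightarrow> ('n \<Rightarrow> 'n state \<Rightarrow> real) \<Rightarrow> ('n \<Rightarrow> 'n state \<Rightarrow> real)
    \<Rightarrow> ('n state \<Rightarrow> real) \<Rightarrow> ('n \<Rightarrow> 'n \<Rightarrow> real \<times> real \<times> real \<Rightarrow> real) \<Rightarrow> bool" where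
  "constitutive F e q \<kappa> b \<longleftrightarrow>
     smooth_on F states \<and> smooth_on \<kappa> states \<and>
     (\<forall>i. smooth_on (e i) states \<and> smooth_on (q i) states) \<and>
     (\<forall>\<omega>\<in>states. (\<Sum>i\<in>UNIV. fst \<omega> $ i * e i \<omega>) = energy_dens F \<omega>) \<and>
     (\<forall>\<omega>\<in>states. (\<Sum>i\<in>UNIV. q i \<omega>) = pressure F \<omega>) \<and>
     (\<forall>\<omega>\<in>states. 0 \<le> \<kappa> \<omega>) \<and>
     (\<forall>i j. i \<noteq> j \<longrightarrow>
        smooth_on (b i j) ({0<..} \<times> {0<..} \<times> {0<..}) \<and>
        (\<forall>r>0. \<forall>s>0. \<forall>\<tau>>0. 0 < b i j (r, s, \<tau>) \<and> b i j (r, s, \<tau>) = b j i (s, r, \<tau>)))"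

definition smooth_fields ::
  "spacetime set \<Rightarrow> (spacetime \<Rightarrow> real^'n::finite) \<Rightarrow> (spacetime \<Rightarrow> real^3) \<Rightarrow> (spacetime \<Rightarrow> real) \<Rightarrow> bool" where
  "smooth_fields D \<rho> v \<theta> \<longleftrightarrow>
     smooth_on \<rho> D \<and> smooth_on v D \<and> smooth_on \<theta> D \<and> (\<forall>z\<in>D. (\<rho> z, \<theta> z) \<in> states)"

definition driving_force ::
  "(('n::finite) state \<Rightarrow> real) \<Rightarrow> ('n \<Rightarrow> 'n state \<Rightarrow> real) \<Rightarrow> ('n \<Rightarrow> 'n state \<Rightarrow> real)
    \<Rightarrow> (spacetime \<Rightarrow> real^'n) \<Rightarrow> (spacetime \<Rightarrow> real) \<Rightarrow> 'n \<Rightarrow> spacetime \<Rightarrow> real^3" where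
  "driving_force F e q \<rho> \<theta> i z =
     - (\<rho> z $ i / total_mass (\<rho> z, \<theta> z)) *\<^sub>R grad (\<lambda>y. pressure F (\<rho> y, \<theta> y)) z
     + (\<rho> z $ i * \<theta> z) *\<^sub>R grad (\<lambda>y. chem_pot F i (\<rho> y, \<theta> y) / \<theta> y) z
     - (\<theta> z * enthalpy e q i (\<rho> z, \<theta> z)) *\<^sub>R grad (\<lambda>y. 1 / \<theta> y) z"

definition diffusive_solution ::
  "spacetime set \<Rightarrow> (('n::finite) state \<Rightarrow> real) \<Rightarrow> ('n \<Rightarrow> 'n state \<Rightarrow> real) \<Rightarrow> ('n \<Rightarrow> 'n state \<Rightarrow> real)
    \<Rightarrow> ('n state \<Rightarrow> real) \<Rightarrow> ('n \<Rightarrow> 'n \<Rightarrow> real \<times> real \<times> real \<Rightarrow> real) \<Rightarrow> real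
    \<Rightarrow> (spacetime \<Rightarrow> real^'n) \<Rightarrow> (spacetime \<Rightarrow> real^3) \<Rightarrow> (spacetime \<Rightarrow> real)
    \<Rightarrow> ('n \<Rightarrow> spacetime \<Rightarrow> real^3) \<Rightarrow> bool" where
  "diffusive_solution D F e q \<kappa> b \<epsilon> \<rho> v \<theta> u \<longleftrightarrow>
     smooth_fields D \<rho> v \<theta> \<and>
     (let \<omega> = (\<lambda>z. (\<rho> z, \<theta> z));
          m = (\<lambda>z. total_mass (\<omega> z));
          p = (\<lambda>z. pressure F (\<omega> z));
          h = (\<lambda>j z. enthalpy e q j (\<omega> z));
          E = (\<lambda>z. energy_dens F (\<omega> z) + 1/2 * m z * (norm (v z))\<^sup>2)
      in \<forall>z\<in>D.
        (\<forall>i. dt (\<lambda>y. \<rho> y $ i) z + divg (\<lambda>y. (\<rho> y $ i) *\<^sub>R v y) z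
              = - divg (\<lambda>y. (\<rho> y $ i) *\<^sub>R u i y) z) \<and>
        dt (\<lambda>y. m y *\<^sub>R v y) z + div_tensor (\<lambda>y. m y *\<^sub>R outer (v y) (v y) + p y *\<^sub>R mat 1) z = 0 \<and>
        dt E z + divg (\<lambda>y. E y *\<^sub>R v y + p y *\<^sub>R v y) z
          = divg (\<lambda>y. \<kappa> (\<omega> y) *\<^sub>R grad \<theta> y - (\<Sum>j\<in>UNIV. h j y *\<^sub>R u j y)) z \<and>
        (\<forall>i. - (\<Sum>j\<in>UNIV - {i}. (b i j (\<rho> z $ i, \<rho> z $ j, \<theta> z) * \<theta> z * \<rho> z $ i * \<rho> z $ j)
                                    *\<^sub>R (u i z - u j z))
              = \<epsilon> *\<^sub>R driving_force F e q \<rho> \<theta> i z) \<and>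
        (\<Sum>i\<in>UNIV. (\<rho> z $ i) *\<^sub>R u i z) = 0)"

definition nondiffusive_solution ::
  "spacetime set \<Rightarrow> (('n::finite) state \<Rightarrow> real) \<Rightarrow> ('n state \<Rightarrow> real)
    \<Rightarrow> (spacetime \<Rightarrow> real^'n) \<Rightarrow> (spacetime \<Rightarrow> real^3) \<Rightarrow> (spacetime \<Rightarrow> real) \<Rightarrow> bool" where
  "nondiffusive_solution D F \<kappa> \<rho> v \<theta> \<longleftrightarrow>
     smooth_fields D \<rho> v \<theta> \<and>
     (let \<omega> = (\<lambda>z. (\<rho> z, \<theta> z));
          m = (\<lambda>z. total_mass (\<omega> z));
          p = (\<lambda>z. pressure F (\<omega> z));
          E = (\<lambda>z. energy_dens F (\<omega> z) + 1/2 * m z * (norm (v z))\<^sup>2)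
      in \<forall>z\<in>D.
        (\<forall>i. dt (\<lambda>y. \<rho> y $ i) z + divg (\<lambda>y. (\<rho> y $ i) *\<^sub>R v y) z = 0) \<and>
        dt (\<lambda>y. m y *\<^sub>R v y) z + div_tensor (\<lambda>y. m y *\<^sub>R outer (v y) (v y) + p y *\<^sub>R mat 1) z = 0 \<and>
        dt E z + divg (\<lambda>y. E y *\<^sub>R v y + p y *\<^sub>R v y) z
          = divg (\<lambda>y. \<kappa> (\<omega> y) *\<^sub>R grad \<theta> y) z)"

(* In the relative entropy identity, with primes for barred quantities, the last term is
     - (1/theta) grad theta' . sum_j (h_j - rho_j mu_j) u_j.
   The source prints 1/theta' in place of 1/theta, and with that coefficient the identity fails.
   Counterexample (n = 2, ideal gas, b_ij = epsilon = kappa = 1, velocities and derivatives along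
   the x axis, abs x < 1/2, c > 0): F = sum_i theta rho_i (ln rho_i - 1) - c theta (ln theta - 1) rho,
   e_i = c theta, p_i = rho_i theta; rho_1 = 1 - 2x, rho_2 = 1 + 2x, v = 0, theta = 1,
   rho_1 u_1 = - rho_2 u_2 = 1; rho'_1 = rho'_2 = 1/(2(1 + x)), v' = 0, theta' = 1 + x. Here
   sum_j (h_j - rho_j mu_j) u_j = ln ((1 + 2x)/(1 - 2x)) is nonzero for x \<noteq> 0. *)

end

theory Submission
  imports Defs
begin

text \<open>The identity is an exact computation with the balance laws; no inequality enters. Write
  \<open>H = \<rho>\<eta>\<close>, \<open>w = v - v'\<close>, \<open>D\<close> and \<open>D'\<close> for the material derivatives along \<open>v\<close> and \<open>v'\<close>, and primes for the
  reference solution.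

  The Gibbs relations \<open>d(\<rho>e) = \<theta> dH + \<Sum>\<^sub>i \<mu>\<^sub>i d\<rho>\<^sub>i\<close> and \<open>dp = \<Sum>\<^sub>i \<rho>\<^sub>i d\<mu>\<^sub>i + H d\<theta>\<close>
  (\<open>gibbs_energy\<close>, \<open>gibbs_duhem\<close>) turn the conservation laws of either system into transport
  equations for \<open>\<rho>\<^sub>i\<close>, \<open>v\<close> and \<open>H\<close> (\<open>mass_convective\<close>, \<open>velocity_convective\<close>, \<open>entropy_convective\<close>). The relative
  energy equals \<open>\<rho>|w|\<^sup>2/2 + \<rho>e - \<Sum>\<^sub>i \<mu>\<^sub>i' \<rho>\<^sub>i - \<theta>'H + p'\<close>, and applying \<open>D\<close> to it gives
  terms with \<open>D'\<mu>\<^sub>i'\<close> and \<open>D'\<theta>'\<close>, terms with gradients tested with \<open>w\<close>, and diffusive terms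
  (\<open>relative_energy_balance\<close>). The chain rule, the reference balance laws and the Maxwell
  relations, that is the symmetry of the second derivatives of the free energy, convert the first
  group into the relative entropy and the relative pressure (\<open>reference_remainders\<close>); the
  second group gives the pressure flux \<open>(p - p') w\<close> and the remaining terms quadratic in differences of
  the two states. In the diffusive group the divergences of the heat and
  diffusion fluxes cancel against those in the flux under the divergence on the left, and products of
  gradients remain (\<open>diffusive_identity\<close>); the constraint \<open>\<Sum>\<^sub>i \<rho>\<^sub>i u\<^sub>i = 0\<close> removes the pressure gradient from the
  dissipation \<open>\<Sum>\<^sub>j u\<^sub>j \<bullet> d\<^sub>j\<close> (\<open>diffusive_dissipation\<close>).

  The product rule for the fluxes needs differentiable velocities \<open>u\<^sub>i\<close>, whereas these are
  given only as solutions of the force balance. That linear system together with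
  the constraint is uniquely solvable with smooth coefficients, so Cramer's rule gives the
  regularity (\<open>diffusional_velocity_differentiable\<close>). For this the smooth functions are shown to be
  closed under algebraic operations, composition and partial differentiation.\<close>


section \<open>Closure properties of smooth functions\<close>

lemma smooth_on_differentiable:
  assumes "smooth_on f S" "x \<in> S"
  shows "f differentiable (at x)"
  using assms unfolding smooth_on_def by (metis Ck_on.simps(2))

lemma smooth_on_directional:
  assumes "smooth_on f S"
  shows "smooth_on (\<lambda>x. frechet_derivative f (at x) w) S"
  using assms unfolding smooth_on_def by (metis Ck_on.simps(2))

lemma smooth_on_continuous: "smooth_on f S \<Longrightarrow> continuous_on S f"
  unfolding smooth_on_def by (metis Ck_on.simps(1))

lemma differentiable_frechet:
  "f differentiable (at x) \<Longrightarrow> (f has_derivative frechet_derivative f (at x)) (at x)"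
  using frechet_derivative_works by blast

lemma frechet_eq: "(f has_derivative f') (at x) \<Longrightarrow> frechet_derivative f (at x) = f'"
  using frechet_derivative_at by metis

lemma Ck_on_cong:
  assumes "open S" "\<And>x. x \<in> S \<Longrightarrow> f x = g x" "Ck_on k f S"
  shows "Ck_on k g S"
  using assms(2,3)
proof (induction k arbitrary: f g)
  case 0
  then show ?case by (metis Ck_on.simps(1) continuous_on_cong)
next
  case (Suc k)
  have der: "(g has_derivative frechet_derivative f (at x)) (at x)" if "x \<in> S" for x
    using Suc.prems that \<open>open S\<close>
    by (intro has_derivative_transform_within_open[of f _ x UNIV S g] differentiable_frechet) auto
  then have "frechet_derivative g (at x) = frechet_derivative f (at x)" if "x \<in> S" for x
    using that frechet_eq by blast
  moreover have "\<forall>w. Ck_on k (\<lambda>x. frechet_derivative f (at x) w) S"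
    using Suc.prems(2) by simp
  ultimately have "\<forall>w. Ck_on k (\<lambda>x. frechet_derivative g (at x) w) S"
    using Suc.IH[of "\<lambda>x. frechet_derivative f (at x) w" "\<lambda>x. frechet_derivative g (at x) w" for w]
    by metis
  with der show ?case
    by (auto intro: differentiableI)
qed

lemma smooth_on_cong:
  assumes "open S" "\<And>x. x \<in> S \<Longrightarrow> f x = g x" "smooth_on f S"
  shows "smooth_on g S"
  using assms Ck_on_cong unfolding smooth_on_def by blast

text \<open>Any explicit formula for the derivative may replace \<open>frechet_derivative\<close>: being \<open>C\<^sup>k\<close> on an open
  set depends only on the values there.\<close>

lemma Ck_on_SucI:
  assumes "open S" "\<And>x. x \<in> S \<Longrightarrow> (f has_derivative f' x) (at x)" "\<And>w. Ck_on k (\<lambda>x. f' x w) S"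
  shows "Ck_on (Suc k) f S"
proof -
  have "Ck_on k (\<lambda>x. frechet_derivative f (at x) w) S" for w
    by (rule Ck_on_cong[OF \<open>open S\<close> _ assms(3)]) (simp add: frechet_eq[OF assms(2)])
  then show ?thesis
    using assms(2) by (auto intro: differentiableI)
qed

lemma Ck_on_SucD: "Ck_on (Suc k) f S \<Longrightarrow> Ck_on k f S"
proof (induction k arbitrary: f)
  case 0
  then show ?case
    by (auto intro!: continuous_at_imp_continuous_on differentiable_imp_continuous_within)
next
  case (Suc k)
  then show ?case by (metis Ck_on.simps(2))
qed

lemma Ck_on_has_derivative:
  "Ck_on (Suc k) f S \<Longrightarrow> x \<in> S \<Longrightarrow> (f has_derivative frechet_derivative f (at x)) (at x)"
  by (auto intro: differentiable_frechet)

lemma Ck_on_const: "Ck_on k (\<lambda>x. c) S"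
  by (induction k arbitrary: c) auto

lemma Ck_on_bounded_linear:
  assumes "open S" "bounded_linear L" "Ck_on k f S"
  shows "Ck_on k (\<lambda>x. L (f x)) S"
  using assms(3)
proof (induction k arbitrary: f)
  case 0
  then show ?case
    using bounded_linear.continuous_on[OF assms(2)] by simp
next
  case (Suc k)
  show ?case
    by (rule Ck_on_SucI[OF \<open>open S\<close>
          bounded_linear.has_derivative[OF assms(2) Ck_on_has_derivative[OF Suc.prems]]])
      (use Suc in auto)
qed

lemma Ck_on_add:
  assumes "open S" "Ck_on k f S" "Ck_on k g S"
  shows "Ck_on k (\<lambda>x. f x + g x) S"
  using assms(2,3)
proof (induction k arbitrary: f g)
  case 0
  then show ?case by (auto intro: continuous_on_add)
next
  case (Suc k)
  show ?case
    by (rule Ck_on_SucI[OF \<open>open S\<close>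
          has_derivative_add[OF Ck_on_has_derivative[OF Suc.prems(1)] Ck_on_has_derivative[OF Suc.prems(2)]]])
      (use Suc in auto)
qed

lemma Ck_on_sum:
  assumes "open S" "\<And>i. i \<in> A \<Longrightarrow> Ck_on k (f i) S"
  shows "Ck_on k (\<lambda>x. \<Sum>i\<in>A. f i x) S"
  using assms(2) by (induction A rule: infinite_finite_induct) (auto intro: Ck_on_const Ck_on_add assms(1))

lemma Ck_on_mult:
  fixes f g :: "'a::real_normed_vector \<Rightarrow> real"
  assumes "open S" "Ck_on k f S" "Ck_on k g S"
  shows "Ck_on k (\<lambda>x. f x * g x) S"
  using assms(2,3)
proof (induction k arbitrary: f g)
  case 0
  then show ?case by (auto intro: continuous_on_mult)
next
  case (Suc k)
  show ?case
    by (rule Ck_on_SucI[OF \<open>open S\<close>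
          has_derivative_mult[OF Ck_on_has_derivative[OF Suc.prems(1)] Ck_on_has_derivative[OF Suc.prems(2)]]])
      (use Suc Ck_on_SucD[OF Suc.prems(1)] Ck_on_SucD[OF Suc.prems(2)]
        in \<open>auto intro!: Ck_on_add[OF assms(1)]\<close>)
qed

lemma Ck_on_inverse:
  fixes f :: "'a::real_normed_vector \<Rightarrow> real"
  assumes "open S" "Ck_on k f S" "\<And>x. x \<in> S \<Longrightarrow> f x \<noteq> 0"
  shows "Ck_on k (\<lambda>x. inverse (f x)) S"
  using assms(2)
proof (induction k)
  case 0
  then show ?case using assms(3) by (auto intro: continuous_on_inverse)
next
  case (Suc k)
  have IH: "Ck_on k (\<lambda>x. inverse (f x)) S"
    using Suc Ck_on_SucD by blast
  have fd: "Ck_on k (\<lambda>x. frechet_derivative f (at x) w) S" for w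
    using Suc.prems by simp
  show ?case
    by (rule Ck_on_SucI[OF \<open>open S\<close>
          Deriv.has_derivative_inverse[OF assms(3) Ck_on_has_derivative[OF Suc.prems]]])
      (auto intro!: Ck_on_mult IH fd assms(1) Ck_on_bounded_linear[OF assms(1) bounded_linear_minus[OF bounded_linear_ident]])
qed

text \<open>The chain rule writes each directional derivative of a composition as a finite sum of
  products of a composition of one order less with a directional derivative of the inner
  function; this is what the induction on the order uses.\<close>

lemma Ck_on_compose:
  fixes G :: "'b::euclidean_space \<Rightarrow> real"
  assumes "open S" "Ck_on k G T" "Ck_on k \<phi> S" "\<And>x. x \<in> S \<Longrightarrow> \<phi> x \<in> T"
  shows "Ck_on k (\<lambda>x. G (\<phi> x)) S"
  using assms(2,3)
proof (induction k arbitrary: G)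
  case 0
  then show ?case
    using assms(4) by (auto intro: continuous_on_compose2)
next
  case (Suc k)
  note dG = Ck_on_has_derivative[OF Suc.prems(1)]
  note d\<phi> = Ck_on_has_derivative[OF Suc.prems(2)]
  have expand: "frechet_derivative G (at y) h
      = (\<Sum>b\<in>Basis. (h \<bullet> b) * frechet_derivative G (at y) b)" if "y \<in> T" for y h
  proof -
    have lin: "linear (frechet_derivative G (at y))"
      using dG[OF that] has_derivative_linear by blast
    have "frechet_derivative G (at y) h = frechet_derivative G (at y) (\<Sum>b\<in>Basis. (h \<bullet> b) *\<^sub>R b)"
      by (simp add: euclidean_representation)
    then show ?thesis
      using lin by (simp add: linear_sum linear_cmul)
  qed
  have der: "((\<lambda>x. G (\<phi> x)) has_derivative
      (\<lambda>w. \<Sum>b\<in>Basis. (frechet_derivative \<phi> (at x) w \<bullet> b) * frechet_derivative G (at (\<phi> x)) b)) (at x)"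
    if "x \<in> S" for x
    by (rule has_derivative_eq_rhs[OF has_derivative_compose[OF d\<phi>[OF that] dG[OF assms(4)[OF that]]]],
        rule ext, rule expand[OF assms(4)[OF that]])
  have \<phi>k: "Ck_on k \<phi> S"
    using Suc.prems Ck_on_SucD by blast
  show ?case
  proof (rule Ck_on_SucI[OF \<open>open S\<close> der])
    fix w
    have "Ck_on k (\<lambda>y. frechet_derivative G (at y) b) T" "Ck_on k (\<lambda>x. frechet_derivative \<phi> (at x) w) S" for b
      using Suc.prems by simp_all
    then show "Ck_on k (\<lambda>x. \<Sum>b\<in>Basis. (frechet_derivative \<phi> (at x) w \<bullet> b) *
                          frechet_derivative G (at (\<phi> x)) b) S"
      using Suc.IH[OF _ \<phi>k, of "\<lambda>y. frechet_derivative G (at y) b" for b]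
      by (intro Ck_on_sum Ck_on_mult Ck_on_bounded_linear[OF assms(1) bounded_linear_inner_left] assms(1))
        simp_all
  qed
qed

lemma Ck_on_Pair:
  assumes "open S" "Ck_on k f S" "Ck_on k g S"
  shows "Ck_on k (\<lambda>x. (f x, g x)) S"
  using assms(2,3)
proof (induction k arbitrary: f g)
  case 0
  then show ?case by (auto intro: continuous_on_Pair)
next
  case (Suc k)
  show ?case
    by (rule Ck_on_SucI[OF \<open>open S\<close>
          has_derivative_Pair[OF Ck_on_has_derivative[OF Suc.prems(1)] Ck_on_has_derivative[OF Suc.prems(2)]]])
      (use Suc in auto)
qed

lemma smooth_on_const: "smooth_on (\<lambda>x. c) S"
  by (simp add: smooth_on_def Ck_on_const)

lemma smooth_on_bounded_linear:
  "open S \<Longrightarrow> bounded_linear L \<Longrightarrow> smooth_on f S \<Longrightarrow> smooth_on (\<lambda>x. L (f x)) S"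
  by (simp add: smooth_on_def Ck_on_bounded_linear)

lemma smooth_on_nth:
  fixes f :: "'a::real_normed_vector \<Rightarrow> real^'n"
  shows "open S \<Longrightarrow> smooth_on f S \<Longrightarrow> smooth_on (\<lambda>x. f x $ i) S"
  using smooth_on_bounded_linear[OF _ bounded_linear_vec_nth] .

lemma smooth_on_add: "open S \<Longrightarrow> smooth_on f S \<Longrightarrow> smooth_on g S \<Longrightarrow> smooth_on (\<lambda>x. f x + g x) S"
  by (simp add: smooth_on_def Ck_on_add)

lemma smooth_on_minus: "open S \<Longrightarrow> smooth_on f S \<Longrightarrow> smooth_on (\<lambda>x. - f x) S"
  using smooth_on_bounded_linear[OF _ bounded_linear_minus[OF bounded_linear_ident]] .

lemma smooth_on_diff: "open S \<Longrightarrow> smooth_on f S \<Longrightarrow> smooth_on g S \<Longrightarrow> smooth_on (\<lambda>x. f x - g x) S"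
  using smooth_on_add[of S f "\<lambda>x. - g x"] smooth_on_minus[of S g] by simp

lemma smooth_on_sum:
  "open S \<Longrightarrow> (\<And>i. i \<in> A \<Longrightarrow> smooth_on (f i) S) \<Longrightarrow> smooth_on (\<lambda>x. \<Sum>i\<in>A. f i x) S"
  by (simp add: smooth_on_def Ck_on_sum)

lemma smooth_on_mult:
  fixes f g :: "'a::real_normed_vector \<Rightarrow> real"
  shows "open S \<Longrightarrow> smooth_on f S \<Longrightarrow> smooth_on g S \<Longrightarrow> smooth_on (\<lambda>x. f x * g x) S"
  by (simp add: smooth_on_def Ck_on_mult)

lemma smooth_on_prod:
  fixes f :: "'i \<Rightarrow> 'a::real_normed_vector \<Rightarrow> real"
  assumes "open S" "\<And>i. i \<in> A \<Longrightarrow> smooth_on (f i) S"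
  shows "smooth_on (\<lambda>x. \<Prod>i\<in>A. f i x) S"
  using assms(2)
  by (induction A rule: infinite_finite_induct) (auto intro: smooth_on_const smooth_on_mult assms(1))

lemma smooth_on_divide:
  fixes f g :: "'a::real_normed_vector \<Rightarrow> real"
  shows "open S \<Longrightarrow> smooth_on f S \<Longrightarrow> smooth_on g S \<Longrightarrow> (\<And>x. x \<in> S \<Longrightarrow> g x \<noteq> 0)
    \<Longrightarrow> smooth_on (\<lambda>x. f x / g x) S"
  by (simp add: smooth_on_def Ck_on_mult Ck_on_inverse divide_inverse)

lemma smooth_on_compose:
  fixes G :: "'b::euclidean_space \<Rightarrow> real"
  shows "open S \<Longrightarrow> smooth_on G T \<Longrightarrow> smooth_on \<phi> S \<Longrightarrow> (\<And>x. x \<in> S \<Longrightarrow> \<phi> x \<in> T)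
    \<Longrightarrow> smooth_on (\<lambda>x. G (\<phi> x)) S"
  by (auto simp: smooth_on_def intro: Ck_on_compose)

lemma smooth_on_Pair: "open S \<Longrightarrow> smooth_on f S \<Longrightarrow> smooth_on g S \<Longrightarrow> smooth_on (\<lambda>x. (f x, g x)) S"
  by (simp add: smooth_on_def Ck_on_Pair)

lemma smooth_on_ident:
  assumes "open S"
  shows "smooth_on (\<lambda>x. x) S"
  unfolding smooth_on_def
proof
  show "Ck_on k (\<lambda>x. x) S" for k
    by (cases k) (auto intro: Ck_on_const)
qed

lemmas smooth_intros = smooth_on_const smooth_on_nth smooth_on_add smooth_on_minus smooth_on_diff
  smooth_on_sum smooth_on_mult smooth_on_prod smooth_on_divide smooth_on_Pair


section \<open>Symmetry of second derivatives\<close>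

text \<open>The mean value theorem is applied in the direction \<open>a\<close> to the difference along \<open>t b\<close>, then in the
  direction \<open>b\<close> to the derivative along \<open>a\<close>. The left-hand side does not change when \<open>a\<close> and \<open>b\<close> are
  exchanged, so the same number is also a value of the derivative taken in the other order.\<close>

lemma second_difference:
  fixes f :: "'a::real_normed_vector \<Rightarrow> real"
  assumes S: "smooth_on f S" and t: "0 < t"
    and in_S: "\<And>r s. \<lbrakk>0 \<le> r; r \<le> t; 0 \<le> s; s \<le> t\<rbrakk> \<Longrightarrow> x + r *\<^sub>R a + s *\<^sub>R b \<in> S"
  shows "\<exists>r s. 0 \<le> r \<and> r \<le> t \<and> 0 \<le> s \<and> s \<le> t \<and>
    f (x + t *\<^sub>R a + t *\<^sub>R b) - f (x + t *\<^sub>R a) - f (x + t *\<^sub>R b) + f x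
      = t * t * frechet_derivative (\<lambda>y. frechet_derivative f (at y) a) (at (x + r *\<^sub>R a + s *\<^sub>R b)) b"
proof -
  have line: "((\<lambda>r. g (y + r *\<^sub>R c)) has_real_derivative frechet_derivative g (at (y + r *\<^sub>R c)) c) (at r)"
    if "smooth_on g S" "y + r *\<^sub>R c \<in> S" for g :: "'a \<Rightarrow> real" and y c r
  proof -
    have d: "(g has_derivative frechet_derivative g (at (y + r *\<^sub>R c))) (at (y + r *\<^sub>R c))"
      using that smooth_on_differentiable differentiable_frechet by blast
    have "((\<lambda>r. y + r *\<^sub>R c) has_derivative (\<lambda>h. h *\<^sub>R c)) (at r)"
      by (auto intro!: derivative_eq_intros)
    from has_derivative_compose[OF this d] show ?thesis
      by (simp add: has_field_derivative_def linear_cmul[OF has_derivative_linear[OF d]]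
          mult_commute_abs)
  qed
  let ?fa = "\<lambda>y. frechet_derivative f (at y) a"
  let ?g = "\<lambda>r. f (x + t *\<^sub>R b + r *\<^sub>R a) - f (x + r *\<^sub>R a)"
  have "\<exists>r. 0 < r \<and> r < t \<and> ?g t - ?g 0 = (t - 0) * (?fa (x + t *\<^sub>R b + r *\<^sub>R a) - ?fa (x + r *\<^sub>R a))"
  proof (rule MVT2[OF t])
    fix r assume r: "0 \<le> r" "r \<le> t"
    show "(?g has_real_derivative ?fa (x + t *\<^sub>R b + r *\<^sub>R a) - ?fa (x + r *\<^sub>R a)) (at r)"
      by (intro DERIV_diff line S)
        (use in_S[OF r, of t] in_S[OF r, of 0] t in \<open>auto simp: algebra_simps\<close>)
  qed
  then obtain r where r: "0 < r" "r < t"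
    and gr: "?g t - ?g 0 = t * (?fa (x + t *\<^sub>R b + r *\<^sub>R a) - ?fa (x + r *\<^sub>R a))"
    by auto
  have "\<exists>s. 0 < s \<and> s < t \<and> ?fa (x + r *\<^sub>R a + t *\<^sub>R b) - ?fa (x + r *\<^sub>R a + 0 *\<^sub>R b)
      = (t - 0) * frechet_derivative ?fa (at (x + r *\<^sub>R a + s *\<^sub>R b)) b"
    by (rule MVT2[OF t]) (use r in_S in \<open>auto intro!: line smooth_on_directional[OF S]\<close>)
  then obtain s where "0 < s" "s < t"
    and "?fa (x + t *\<^sub>R b + r *\<^sub>R a) - ?fa (x + r *\<^sub>R a)
      = t * frechet_derivative ?fa (at (x + r *\<^sub>R a + s *\<^sub>R b)) b"
    by (auto simp: algebra_simps)
  then show ?thesis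
    using r gr by (intro exI[of _ r] exI[of _ s]) (auto simp: algebra_simps)
qed

text \<open>If the two orders gave different values at \<open>x\<close>, then by continuity they would give different
  values at any two points close to \<open>x\<close>, but \<open>second_difference\<close> provides two such points with
  equal values.\<close>

lemma symmetric_second_derivative:
  fixes f :: "'a::real_normed_vector \<Rightarrow> real"
  assumes "open S" and S: "smooth_on f S" and x: "x \<in> S"
  shows "frechet_derivative (\<lambda>y. frechet_derivative f (at y) a) (at x) b
       = frechet_derivative (\<lambda>y. frechet_derivative f (at y) b) (at x) a"
proof (rule ccontr)
  define G where "G = (\<lambda>a b y. frechet_derivative (\<lambda>y. frechet_derivative f (at y) a) (at y) b)"
  assume "\<not> ?thesis"
  then have ne: "G a b x \<noteq> G b a x" by (simp add: G_def)
  have cont: "continuous (at x) (G c d)" for c d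
    using smooth_on_continuous[OF smooth_on_directional[OF smooth_on_directional[OF S]]]
      continuous_on_eq_continuous_at[OF \<open>open S\<close>] x unfolding G_def by blast
  define \<epsilon> where "\<epsilon> = \<bar>G a b x - G b a x\<bar> / 2"
  have "\<epsilon> > 0" using ne by (simp add: \<epsilon>_def)
  obtain d0 where d0: "d0 > 0" "ball x d0 \<subseteq> S"
    using \<open>open S\<close> x open_contains_ball by blast
  obtain d1 where d1: "d1 > 0" "\<And>y. dist y x < d1 \<Longrightarrow> dist (G a b y) (G a b x) < \<epsilon>"
    using cont[of a b] \<open>\<epsilon> > 0\<close> unfolding continuous_at_eps_delta by (auto simp: dist_commute)
  obtain d2 where d2: "d2 > 0" "\<And>y. dist y x < d2 \<Longrightarrow> dist (G b a y) (G b a x) < \<epsilon>"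
    using cont[of b a] \<open>\<epsilon> > 0\<close> unfolding continuous_at_eps_delta by (auto simp: dist_commute)
  define d where "d = min d0 (min d1 d2)"
  have "d > 0" using d0 d1 d2 by (simp add: d_def)
  define t where "t = d / (norm a + norm b + 1)"
  have "norm a + norm b + 1 > 0"
    by (smt (verit) norm_ge_zero)
  then have "t > 0"
    using \<open>d > 0\<close> by (simp add: t_def)
  have near: "dist (x + r *\<^sub>R a + s *\<^sub>R b) x < d" if "0 \<le> r" "r \<le> t" "0 \<le> s" "s \<le> t" for r s
  proof -
    have "norm (r *\<^sub>R a + s *\<^sub>R b) \<le> t * norm a + t * norm b"
      using that by (intro order_trans[OF norm_triangle_ineq] add_mono) (auto intro: mult_right_mono)
    also have "\<dots> < t * (norm a + norm b + 1)"
      using \<open>t > 0\<close> by (simp add: algebra_simps)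
    also have "\<dots> = d"
      using \<open>norm a + norm b + 1 > 0\<close> by (simp add: t_def)
    finally show ?thesis
      by (simp add: dist_norm)
  qed
  then have in_S: "x + r *\<^sub>R a + s *\<^sub>R b \<in> S" if "0 \<le> r" "r \<le> t" "0 \<le> s" "s \<le> t" for r s
    using that d0 unfolding d_def
    by (meson dist_commute_lessI less_le_trans mem_ball min.cobounded1 subsetD)
  obtain r s where rs: "0 \<le> r" "r \<le> t" "0 \<le> s" "s \<le> t"
    "f (x + t *\<^sub>R a + t *\<^sub>R b) - f (x + t *\<^sub>R a) - f (x + t *\<^sub>R b) + f x = t * t * G a b (x + r *\<^sub>R a + s *\<^sub>R b)"
    using second_difference[OF S \<open>t > 0\<close> in_S] unfolding G_def by auto
  have in_S': "x + r *\<^sub>R b + s *\<^sub>R a \<in> S" if "0 \<le> r" "r \<le> t" "0 \<le> s" "s \<le> t" for r s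
    using in_S[of s r] that by (simp add: algebra_simps)
  obtain r' s' where rs': "0 \<le> r'" "r' \<le> t" "0 \<le> s'" "s' \<le> t"
    "f (x + t *\<^sub>R b + t *\<^sub>R a) - f (x + t *\<^sub>R b) - f (x + t *\<^sub>R a) + f x = t * t * G b a (x + r' *\<^sub>R b + s' *\<^sub>R a)"
    using second_difference[OF S \<open>t > 0\<close> in_S'] unfolding G_def by auto
  have "t * t * G a b (x + r *\<^sub>R a + s *\<^sub>R b) = t * t * G b a (x + r' *\<^sub>R b + s' *\<^sub>R a)"
    using rs(5) rs'(5) by (simp add: algebra_simps)
  then have "G a b (x + r *\<^sub>R a + s *\<^sub>R b) = G b a (x + s' *\<^sub>R a + r' *\<^sub>R b)"
    using \<open>t > 0\<close> by (simp add: algebra_simps)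
  moreover have "\<bar>G a b (x + r *\<^sub>R a + s *\<^sub>R b) - G a b x\<bar> < \<epsilon>"
    using d1(2) near[OF rs(1-4)] by (simp add: d_def dist_real_def)
  moreover have "\<bar>G b a (x + s' *\<^sub>R a + r' *\<^sub>R b) - G b a x\<bar> < \<epsilon>"
    using d2(2) near[OF rs'(3,4,1,2)] by (simp add: d_def dist_real_def)
  ultimately show False
    unfolding \<epsilon>_def by (simp add: abs_if field_simps split: if_splits)
qed

section \<open>Space-time derivatives\<close>

lemma dt_eq:
  assumes "f differentiable (at z)"
  shows "dt f z = frechet_derivative f (at z) (1, 0)"
proof -
  have f: "(f has_derivative frechet_derivative f (at z)) (at (fst z, snd z))"
    using differentiable_frechet[OF assms] by simp
  have "((\<lambda>s. (s, snd z)) has_derivative (\<lambda>h. (h, 0))) (at (fst z))"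
    by (auto intro!: derivative_eq_intros)
  note comp = has_derivative_compose[OF this f]
  have "(\<lambda>h. frechet_derivative f (at z) (h, 0)) = (\<lambda>h. h *\<^sub>R frechet_derivative f (at z) (1, 0))"
  proof
    show "frechet_derivative f (at z) (h, 0) = h *\<^sub>R frechet_derivative f (at z) (1, 0)" for h
      using linear_cmul[OF has_derivative_linear[OF f], of h "(1, 0)"] by simp
  qed
  with comp have "((\<lambda>s. f (s, snd z)) has_vector_derivative frechet_derivative f (at z) (1, 0)) (at (fst z))"
    unfolding has_vector_derivative_def by (simp only:)
  then show ?thesis
    unfolding dt_def by (rule vector_derivative_at)
qed

lemma deriv_line:
  fixes G :: "'a::real_normed_vector \<Rightarrow> real"
  assumes "G differentiable (at x)"
  shows "deriv (\<lambda>s. G (x + s *\<^sub>R c)) 0 = frechet_derivative G (at x) c"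
proof -
  have G: "(G has_derivative frechet_derivative G (at x)) (at (x + 0 *\<^sub>R c))"
    using differentiable_frechet[OF assms] by simp
  have "((\<lambda>s. x + s *\<^sub>R c) has_derivative (\<lambda>h. h *\<^sub>R c)) (at 0)"
    by (auto intro!: derivative_eq_intros)
  from has_derivative_compose[OF this G]
  have "((\<lambda>s. G (x + s *\<^sub>R c)) has_real_derivative frechet_derivative G (at x) c) (at 0)"
    by (simp add: has_field_derivative_def linear_cmul[OF has_derivative_linear[OF G]] mult_commute_abs)
  then show ?thesis
    by (rule DERIV_imp_deriv)
qed

lemma dx_eq:
  assumes "f differentiable (at z)"
  shows "dx \<alpha> f z = frechet_derivative f (at z) (0, axis \<alpha> 1)"
proof -
  have "(\<lambda>s. f (fst z, snd z + s *\<^sub>R axis \<alpha> 1)) = (\<lambda>s. f (z + s *\<^sub>R (0, axis \<alpha> 1)))"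
    by (cases z) simp
  then show ?thesis
    using deriv_line[OF assms, of "(0, axis \<alpha> 1)"] unfolding dx_def by simp
qed

lemma grad_nth: "grad f z $ \<alpha> = dx \<alpha> f z"
  by (simp add: grad_def)

text \<open>Gradients and time derivatives are read off one total derivative. A material derivative is
  then a derivative in the single direction \<open>(1, w)\<close>, to which the product rule and the Gibbs
  relations apply at once.\<close>

lemma grad_inner:
  assumes "f differentiable (at z)"
  shows "w \<bullet> grad f z = frechet_derivative f (at z) (0, w)"
proof -
  have lin: "linear (frechet_derivative f (at z))"
    using assms by (rule linear_frechet_derivative)
  have "w = (\<Sum>\<alpha>\<in>UNIV. w $ \<alpha> *\<^sub>R axis \<alpha> 1)"
    by (simp add: vec_eq_iff axis_def if_distrib cong: if_cong)
  then have "(0::real, w) = (\<Sum>\<alpha>\<in>UNIV. w $ \<alpha> *\<^sub>R (0, axis \<alpha> 1))"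
    by (simp add: prod_eq_iff fst_sum snd_sum)
  then have "frechet_derivative f (at z) (0, w)
      = (\<Sum>\<alpha>\<in>UNIV. w $ \<alpha> * frechet_derivative f (at z) (0, axis \<alpha> 1))"
    using lin by (simp only: linear_sum linear_cmul real_scaleR_def)
  then show ?thesis
    using assms by (simp add: inner_vec_def grad_nth dx_eq)
qed

lemma material_derivative:
  fixes f :: "spacetime \<Rightarrow> real"
  assumes "f differentiable (at z)"
  shows "dt f z + w \<bullet> grad f z = frechet_derivative f (at z) (1, w)"
proof -
  have "frechet_derivative f (at z) ((1, 0) + (0, w))
      = frechet_derivative f (at z) (1, 0) + frechet_derivative f (at z) (0, w)"
    using linear_frechet_derivative[OF assms] by (rule linear_add)
  then show ?thesis
    using assms by (simp add: dt_eq grad_inner)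
qed

lemma smooth_on_dx: "open D \<Longrightarrow> smooth_on f D \<Longrightarrow> smooth_on (dx \<alpha> f) D"
  by (rule smooth_on_cong[OF _ _ smooth_on_directional[of f D "(0, axis \<alpha> 1)"]])
    (auto simp: dx_eq smooth_on_differentiable)

lemma frechet_add:
  "f differentiable (at z) \<Longrightarrow> g differentiable (at z) \<Longrightarrow>
   frechet_derivative (\<lambda>y. f y + g y) (at z) h
     = frechet_derivative f (at z) h + frechet_derivative g (at z) h"
  by (subst frechet_eq[OF has_derivative_add[OF differentiable_frechet differentiable_frechet]]) auto

lemma frechet_diff:
  "f differentiable (at z) \<Longrightarrow> g differentiable (at z) \<Longrightarrow>
   frechet_derivative (\<lambda>y. f y - g y) (at z) h
     = frechet_derivative f (at z) h - frechet_derivative g (at z) h"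
  by (subst frechet_eq[OF has_derivative_diff[OF differentiable_frechet differentiable_frechet]]) auto

lemma frechet_minus:
  "f differentiable (at z) \<Longrightarrow>
   frechet_derivative (\<lambda>y. - f y) (at z) h = - frechet_derivative f (at z) h"
  by (subst frechet_eq[OF has_derivative_minus[OF differentiable_frechet]]) auto

lemma frechet_sum:
  "(\<And>i. i \<in> A \<Longrightarrow> f i differentiable (at z)) \<Longrightarrow>
   frechet_derivative (\<lambda>y. \<Sum>i\<in>A. f i y) (at z) h = (\<Sum>i\<in>A. frechet_derivative (f i) (at z) h)"
  by (subst frechet_eq[OF has_derivative_sum[OF differentiable_frechet]]) auto

lemma frechet_mult:
  fixes f g :: "'a::real_normed_vector \<Rightarrow> real"
  shows "f differentiable (at z) \<Longrightarrow> g differentiable (at z) \<Longrightarrow>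
   frechet_derivative (\<lambda>y. f y * g y) (at z) h
     = frechet_derivative f (at z) h * g z + f z * frechet_derivative g (at z) h"
  by (subst frechet_eq[OF has_derivative_mult[OF differentiable_frechet differentiable_frechet]]) auto

lemma frechet_divide:
  fixes f g :: "'a::real_normed_vector \<Rightarrow> real"
  shows "f differentiable (at z) \<Longrightarrow> g differentiable (at z) \<Longrightarrow> g z \<noteq> 0 \<Longrightarrow>
   frechet_derivative (\<lambda>y. f y / g y) (at z) h
     = frechet_derivative f (at z) h / g z - f z * frechet_derivative g (at z) h / (g z)\<^sup>2"
  by (subst frechet_eq[OF has_derivative_divide'[OF differentiable_frechet differentiable_frechet]])
    (auto simp: power2_eq_square diff_divide_distrib)

lemmas frechet_simps = frechet_add frechet_diff frechet_minus frechet_sum frechet_mult frechet_divide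

lemma differentiable_nth:
  fixes V :: "'a::real_normed_vector \<Rightarrow> real^'n"
  assumes "V differentiable (at z)"
  shows "(\<lambda>y. V y $ \<alpha>) differentiable (at z)"
  using assms bounded_linear.has_derivative[OF bounded_linear_vec_nth] unfolding differentiable_def by blast

lemma differentiable_vecI:
  fixes V :: "'a::real_normed_vector \<Rightarrow> real^'n"
  assumes "\<And>\<alpha>. (\<lambda>y. V y $ \<alpha>) differentiable (at z)"
  shows "V differentiable (at z)"
proof -
  have "V = (\<lambda>y. \<Sum>\<alpha>\<in>UNIV. V y $ \<alpha> *\<^sub>R axis \<alpha> 1)"
    by (simp add: vec_eq_iff axis_def if_distrib fun_eq_iff cong: if_cong)
  moreover have "(\<lambda>y. \<Sum>\<alpha>\<in>UNIV. V y $ \<alpha> *\<^sub>R axis \<alpha> (1::real)) differentiable (at z)"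
    using assms by (auto intro!: differentiable_sum)
  ultimately show ?thesis by simp
qed

lemma grad_diff:
  "f differentiable (at z) \<Longrightarrow> g differentiable (at z) \<Longrightarrow>
   grad (\<lambda>y. f y - g y) z = grad f z - grad g z"
  by (simp add: vec_eq_iff grad_nth dx_eq frechet_diff)

lemma grad_mult:
  "f differentiable (at z) \<Longrightarrow> g differentiable (at z) \<Longrightarrow>
   grad (\<lambda>y. f y * g y) z = g z *\<^sub>R grad f z + f z *\<^sub>R grad g z"
  by (simp add: vec_eq_iff grad_nth dx_eq frechet_mult algebra_simps)

lemma grad_divide:
  "f differentiable (at z) \<Longrightarrow> g differentiable (at z) \<Longrightarrow> g z \<noteq> 0 \<Longrightarrow>
   grad (\<lambda>y. f y / g y) z = (1 / g z) *\<^sub>R grad f z - (f z / (g z)\<^sup>2) *\<^sub>R grad g z"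
  by (simp add: vec_eq_iff grad_nth dx_eq frechet_divide)

lemma grad_const: "grad (\<lambda>y. c) z = 0"
  by (simp add: vec_eq_iff grad_nth dx_eq)

lemma divg_add:
  "V differentiable (at z) \<Longrightarrow> W differentiable (at z) \<Longrightarrow>
   divg (\<lambda>y. V y + W y) z = divg V z + divg W z"
  by (simp add: divg_def dx_eq frechet_add differentiable_nth sum.distrib)

lemma divg_diff:
  "V differentiable (at z) \<Longrightarrow> W differentiable (at z) \<Longrightarrow>
   divg (\<lambda>y. V y - W y) z = divg V z - divg W z"
  by (simp add: divg_def dx_eq frechet_diff differentiable_nth sum_subtractf)

lemma divg_sum:
  "finite A \<Longrightarrow> (\<And>i. i \<in> A \<Longrightarrow> V i differentiable (at z)) \<Longrightarrow>
   divg (\<lambda>y. \<Sum>i\<in>A. V i y) z = (\<Sum>i\<in>A. divg (V i) z)"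
  unfolding divg_def
  by (subst sum.swap) (auto simp: dx_eq frechet_sum differentiable_nth intro!: sum.cong)

lemma divg_scaleR:
  "f differentiable (at z) \<Longrightarrow> V differentiable (at z) \<Longrightarrow>
   divg (\<lambda>y. f y *\<^sub>R V y) z = V z \<bullet> grad f z + f z * divg V z"
  by (simp add: divg_def dx_eq frechet_mult differentiable_nth sum.distrib sum_distrib_left
      inner_vec_def grad_nth algebra_simps)

lemma divg_zero_on_open:
  assumes "open D" "z \<in> D" "\<And>y. y \<in> D \<Longrightarrow> V y = 0"
  shows "divg V z = 0"
proof -
  have "((\<lambda>y. V y $ \<alpha>) has_derivative (\<lambda>h. 0)) (at z)" for \<alpha>
    by (rule has_derivative_transform_within_open[OF has_derivative_const[of 0] assms(1,2)])
      (simp add: assms(3))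
  from dx_eq[OF differentiableI[OF this]] frechet_eq[OF this]
  have "dx \<alpha> (\<lambda>y. V y $ \<alpha>) z = 0" for \<alpha>
    by simp
  then show ?thesis
    by (simp add: divg_def)
qed

lemma div_tensor_flux:
  assumes "f differentiable (at z)" "p differentiable (at z)" "v differentiable (at z)"
  shows "div_tensor (\<lambda>y. f y *\<^sub>R outer (v y) (v y) + p y *\<^sub>R mat 1) z $ \<beta>
    = divg (\<lambda>y. (f y * v y $ \<beta>) *\<^sub>R v y) z + grad p z $ \<beta>"
proof -
  have "dx \<alpha> (\<lambda>y. (f y *\<^sub>R outer (v y) (v y) + p y *\<^sub>R mat 1) $ \<alpha> $ \<beta>) z
      = dx \<alpha> (\<lambda>y. ((f y * v y $ \<beta>) *\<^sub>R v y) $ \<alpha>) z + (if \<alpha> = \<beta> then dx \<beta> p z else 0)" for \<alpha>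
    using assms by (simp add: outer_def mat_def dx_eq differentiable_nth frechet_simps algebra_simps)
  then show ?thesis
    by (simp add: div_tensor_def divg_def sum.distrib grad_nth)
qed

lemma grad_quad_eq: "grad_quad w v z = (\<Sum>\<beta>\<in>UNIV. w $ \<beta> * (w \<bullet> grad (\<lambda>y. v y $ \<beta>) z))"
  unfolding grad_quad_def
  by (subst sum.swap) (simp add: inner_vec_def grad_nth sum_distrib_left algebra_simps)


section \<open>Thermodynamic relations\<close>

lemma open_states: "open states"
proof -
  have "states = (\<Inter>i. {\<omega>::('n::finite) state. 0 < fst \<omega> $ i}) \<inter> {\<omega>. 0 < snd \<omega>}"
    by (auto simp: states_def)
  also have "open \<dots>"
    by (intro open_Int open_INT ballI open_Collect_less continuous_intros) simp
  finally show ?thesis .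
qed

lemma d_rho_eq:
  assumes "F differentiable (at \<omega>)"
  shows "d_rho j F \<omega> = frechet_derivative F (at \<omega>) (axis j 1, 0)"
proof -
  have "(\<lambda>s. F (fst \<omega> + s *\<^sub>R axis j 1, snd \<omega>)) = (\<lambda>s. F (\<omega> + s *\<^sub>R (axis j 1, 0)))"
    by (cases \<omega>) simp
  then show ?thesis
    using deriv_line[OF assms, of "(axis j 1, 0)"] unfolding d_rho_def by simp
qed

lemma d_theta_eq:
  assumes "F differentiable (at \<omega>)"
  shows "d_theta F \<omega> = frechet_derivative F (at \<omega>) (0, 1)"
proof -
  have F: "(F has_derivative frechet_derivative F (at \<omega>)) (at (fst \<omega>, snd \<omega>))"
    using differentiable_frechet[OF assms] by simp
  have "((\<lambda>s. (fst \<omega>, s)) has_derivative (\<lambda>h. (0, h))) (at (snd \<omega>))"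
    by (auto intro!: derivative_eq_intros)
  note comp = has_derivative_compose[OF this F]
  have "(\<lambda>h. frechet_derivative F (at \<omega>) (0, h)) = (*) (frechet_derivative F (at \<omega>) (0, 1))"
  proof
    show "frechet_derivative F (at \<omega>) (0, h) = frechet_derivative F (at \<omega>) (0, 1) * h" for h
      using linear_cmul[OF has_derivative_linear[OF F], of h "(0, 1)"] by (simp add: mult.commute)
  qed
  with comp have "((\<lambda>s. F (fst \<omega>, s)) has_real_derivative frechet_derivative F (at \<omega>) (0, 1)) (at (snd \<omega>))"
    unfolding has_field_derivative_def by (simp only:)
  then show ?thesis
    unfolding d_theta_def by (rule DERIV_imp_deriv)
qed

lemma frechet_state:
  fixes F :: "('n::finite) state \<Rightarrow> real"
  assumes "F differentiable (at \<omega>)"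
  shows "frechet_derivative F (at \<omega>) h = (\<Sum>j\<in>UNIV. d_rho j F \<omega> * fst h $ j) + d_theta F \<omega> * snd h"
proof -
  have lin: "linear (frechet_derivative F (at \<omega>))"
    using assms by (rule linear_frechet_derivative)
  have "fst h = (\<Sum>j\<in>UNIV. fst h $ j *\<^sub>R axis j 1)"
    by (simp add: vec_eq_iff axis_def if_distrib cong: if_cong)
  then have "h = (\<Sum>j\<in>UNIV. fst h $ j *\<^sub>R (axis j 1, 0)) + snd h *\<^sub>R (0, 1)"
    by (simp add: prod_eq_iff fst_sum snd_sum)
  then have "frechet_derivative F (at \<omega>) h = frechet_derivative F (at \<omega>)
      ((\<Sum>j\<in>UNIV. fst h $ j *\<^sub>R (axis j 1, 0)) + snd h *\<^sub>R (0, 1))"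
    by simp
  then show ?thesis
    using lin assms
    by (simp only: linear_add linear_sum linear_cmul d_rho_eq d_theta_eq)
      (simp add: mult.commute)
qed

lemma smooth_on_d_rho: "smooth_on F states \<Longrightarrow> smooth_on (d_rho j F) states"
  by (rule smooth_on_cong[OF open_states _ smooth_on_directional[of F states "(axis j 1, 0)"]])
    (auto simp: d_rho_eq smooth_on_differentiable)

lemma smooth_on_d_theta: "smooth_on F states \<Longrightarrow> smooth_on (d_theta F) states"
  by (rule smooth_on_cong[OF open_states _ smooth_on_directional[of F states "(0, 1)"]])
    (auto simp: d_theta_eq smooth_on_differentiable)

lemma bounded_linear_fst_nth: "bounded_linear (\<lambda>\<omega>::('n::finite) state. fst \<omega> $ i)"
  using bounded_linear_compose[OF bounded_linear_vec_nth bounded_linear_fst] .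

lemma smooth_on_fst_nth: "smooth_on (\<lambda>\<omega>::('n::finite) state. fst \<omega> $ i) states"
  by (rule smooth_on_bounded_linear[OF open_states bounded_linear_fst_nth smooth_on_ident[OF open_states]])

lemma smooth_on_snd: "smooth_on (\<lambda>\<omega>::('n::finite) state. snd \<omega>) states"
  by (rule smooth_on_bounded_linear[OF open_states bounded_linear_snd smooth_on_ident[OF open_states]])

lemma smooth_on_chem_pot: "smooth_on F states \<Longrightarrow> smooth_on (chem_pot F i) states"
  using smooth_on_d_rho[of F i] unfolding chem_pot_def[abs_def] by simp

lemma smooth_on_entropy_dens: "smooth_on F states \<Longrightarrow> smooth_on (entropy_dens F) states"
  unfolding entropy_dens_def[abs_def] by (intro smooth_on_minus open_states smooth_on_d_theta)

lemma smooth_on_energy_dens: "smooth_on F states \<Longrightarrow> smooth_on (energy_dens F) states"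
  unfolding energy_dens_def[abs_def]
  by (intro smooth_intros open_states smooth_on_entropy_dens smooth_on_snd)

lemma smooth_on_pressure: "smooth_on F states \<Longrightarrow> smooth_on (pressure F) states"
  unfolding pressure_def[abs_def]
  by (intro smooth_intros open_states smooth_on_chem_pot smooth_on_fst_nth)

text \<open>Adding \<open>\<rho>\<eta>\<theta>\<close> to the free energy cancels its \<open>\<theta>\<close>-derivative, and the Legendre transform in the
  densities cancels its \<open>\<rho>\<^sub>i\<close>-derivatives.\<close>

lemma gibbs_energy:
  assumes F: "smooth_on F states" and \<omega>: "\<omega> \<in> states"
  shows "frechet_derivative (energy_dens F) (at \<omega>) h
    = (\<Sum>i\<in>UNIV. chem_pot F i \<omega> * fst h $ i) + snd \<omega> * frechet_derivative (entropy_dens F) (at \<omega>) h"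
proof -
  note diff = smooth_on_differentiable[OF _ \<omega>]
  have snd: "frechet_derivative snd (at \<omega>) h = snd h"
    by (simp add: frechet_eq[OF bounded_linear_imp_has_derivative[OF bounded_linear_snd]])
  have "frechet_derivative (energy_dens F) (at \<omega>) h
    = frechet_derivative F (at \<omega>) h + (frechet_derivative (entropy_dens F) (at \<omega>) h * snd \<omega>
        + entropy_dens F \<omega> * snd h)"
    unfolding energy_dens_def[abs_def]
    using diff[OF F] diff[OF smooth_on_entropy_dens[OF F]] diff[OF smooth_on_snd]
    by (simp add: frechet_add frechet_mult snd)
  then show ?thesis
    by (simp add: frechet_state[OF diff[OF F]] entropy_dens_def chem_pot_def algebra_simps)
qed

lemma gibbs_duhem:
  assumes F: "smooth_on F states" and \<omega>: "\<omega> \<in> states"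
  shows "frechet_derivative (pressure F) (at \<omega>) h
    = (\<Sum>i\<in>UNIV. fst \<omega> $ i * frechet_derivative (chem_pot F i) (at \<omega>) h) + entropy_dens F \<omega> * snd h"
proof -
  note diff = smooth_on_differentiable[OF _ \<omega>]
  have fst: "frechet_derivative (\<lambda>\<omega>. fst \<omega> $ i) (at \<omega>) h = fst h $ i" for i
    by (simp add: frechet_eq[OF bounded_linear_imp_has_derivative[OF bounded_linear_fst_nth]])
  have "frechet_derivative (pressure F) (at \<omega>) h
    = (\<Sum>i\<in>UNIV. fst h $ i * chem_pot F i \<omega> + fst \<omega> $ i * frechet_derivative (chem_pot F i) (at \<omega>) h)
      - frechet_derivative F (at \<omega>) h"
    unfolding pressure_def[abs_def]
    using diff[OF F] diff[OF smooth_on_chem_pot[OF F]] diff[OF smooth_on_fst_nth]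
    by (simp add: frechet_diff frechet_mult frechet_sum fst)
  then show ?thesis
    by (simp add: frechet_state[OF diff[OF F]] entropy_dens_def chem_pot_def sum.distrib mult.commute)
qed

text \<open>The Maxwell relations hold because \<open>\<mu>\<^sub>j\<close> and \<open>-\<rho>\<eta>\<close> are first derivatives of the same function \<open>F\<close>,
  whose Hessian is symmetric.\<close>

lemma maxwell_chem_pot:
  assumes F: "smooth_on F states" and \<omega>: "\<omega> \<in> states"
  shows "d_rho i (chem_pot F j) \<omega> = d_rho j (chem_pot F i) \<omega>"
proof -
  have "frechet_derivative (chem_pot F k) (at \<omega>)
      = frechet_derivative (\<lambda>x. frechet_derivative F (at x) (axis k 1, 0)) (at \<omega>)" for k
    by (rule frechet_derivative_transform_within_open[OF _ open_states \<omega>])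
      (auto simp: chem_pot_def d_rho_eq smooth_on_differentiable[OF F]
        smooth_on_differentiable[OF smooth_on_chem_pot[OF F] \<omega>])
  then show ?thesis
    using symmetric_second_derivative[OF open_states F \<omega>, of "(axis i 1, 0)" "(axis j 1, 0)"]
    by (simp add: d_rho_eq smooth_on_differentiable[OF smooth_on_chem_pot[OF F] \<omega>])
qed

lemma maxwell_entropy:
  assumes F: "smooth_on F states" and \<omega>: "\<omega> \<in> states"
  shows "d_theta (chem_pot F j) \<omega> = - d_rho j (entropy_dens F) \<omega>"
proof -
  have \<mu>: "frechet_derivative (chem_pot F j) (at \<omega>)
      = frechet_derivative (\<lambda>x. frechet_derivative F (at x) (axis j 1, 0)) (at \<omega>)"
    by (rule frechet_derivative_transform_within_open[OF _ open_states \<omega>])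
      (auto simp: chem_pot_def d_rho_eq smooth_on_differentiable[OF F]
        smooth_on_differentiable[OF smooth_on_chem_pot[OF F] \<omega>])
  have H: "frechet_derivative (entropy_dens F) (at \<omega>)
      = frechet_derivative (\<lambda>x. - frechet_derivative F (at x) (0, 1)) (at \<omega>)"
    by (rule frechet_derivative_transform_within_open[OF _ open_states \<omega>])
      (auto simp: entropy_dens_def d_theta_eq smooth_on_differentiable[OF F]
        smooth_on_differentiable[OF smooth_on_entropy_dens[OF F] \<omega>])
  show ?thesis
    using symmetric_second_derivative[OF open_states F \<omega>, of "(axis j 1, 0)" "(0, 1)"]
    by (simp add: d_rho_eq d_theta_eq \<mu> H frechet_minus
        smooth_on_differentiable[OF smooth_on_directional[OF F] \<omega>]
        smooth_on_differentiable[OF smooth_on_chem_pot[OF F] \<omega>]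
        smooth_on_differentiable[OF smooth_on_entropy_dens[OF F] \<omega>])
qed

text \<open>The Maxwell relations move the density derivative inside the sums from the index \<open>i\<close> to the index
  \<open>j\<close> of the factor \<open>\<rho>\<^sub>j\<close>. In this form the sums appear when \<open>\<mu>\<^sub>i\<close> and the entropy density are
  differentiated along a flow in which each \<open>\<rho>\<^sub>j\<close> has the material derivative \<open>-\<rho>\<^sub>j div v\<close>.\<close>

lemma pressure_d_rho:
  assumes F: "smooth_on F states" and \<omega>: "\<omega> \<in> states"
  shows "d_rho i (pressure F) \<omega> = (\<Sum>j\<in>UNIV. d_rho j (chem_pot F i) \<omega> * fst \<omega> $ j)"
  using gibbs_duhem[OF F \<omega>, of "(axis i 1, 0)"]
  by (simp add: d_rho_eq[symmetric] smooth_on_differentiable[OF smooth_on_pressure[OF F] \<omega>]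
      smooth_on_differentiable[OF smooth_on_chem_pot[OF F] \<omega>] maxwell_chem_pot[OF F \<omega>, of i] mult.commute)

lemma pressure_d_theta:
  assumes F: "smooth_on F states" and \<omega>: "\<omega> \<in> states"
  shows "d_theta (pressure F) \<omega> = entropy_dens F \<omega> - (\<Sum>j\<in>UNIV. d_rho j (entropy_dens F) \<omega> * fst \<omega> $ j)"
  using gibbs_duhem[OF F \<omega>, of "(0, 1)"]
  by (simp add: d_theta_eq[symmetric] smooth_on_differentiable[OF smooth_on_pressure[OF F] \<omega>]
      smooth_on_differentiable[OF smooth_on_chem_pot[OF F] \<omega>] maxwell_entropy[OF F \<omega>] mult.commute
      sum_negf)

section \<open>Regularity of the diffusional velocities\<close>

lemma smooth_on_det:
  fixes A :: "'a::real_normed_vector \<Rightarrow> real^'n^'n"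
  assumes "open D" "\<And>i j. smooth_on (\<lambda>z. A z $ i $ j) D"
  shows "smooth_on (\<lambda>z. det (A z)) D"
  unfolding det_def by (intro smooth_on_sum smooth_on_mult smooth_on_prod smooth_on_const assms)

text \<open>A linear system \<open>\<Sum>\<^sub>j B\<^sub>i\<^sub>j (x\<^sub>i - x\<^sub>j) = r\<^sub>i\<close> with symmetric positive weights is singular, its kernel
  being the constant vectors. The constraint \<open>\<Sum>\<^sub>j a\<^sub>j x\<^sub>j = 0\<close> with positive \<open>a\<close> removes the kernel:
  adding \<open>a\<^sub>i \<Sum>\<^sub>j a\<^sub>j x\<^sub>j\<close> to the \<open>i\<close>-th equation changes no solution that satisfies the constraint
  and gives an invertible matrix, so that by Cramer's rule the solution is as smooth as the data.\<close>

lemma constrained_laplacian_solution_smooth: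
  fixes B :: "'n::finite \<Rightarrow> 'n \<Rightarrow> 'a::real_normed_vector \<Rightarrow> real"
    and a r x :: "'n \<Rightarrow> 'a \<Rightarrow> real"
  assumes "open D"
    and B: "\<And>i j. i \<noteq> j \<Longrightarrow> smooth_on (B i j) D"
    and a: "\<And>i. smooth_on (a i) D"
    and r: "\<And>i. smooth_on (r i) D"
    and B_pos: "\<And>i j z. i \<noteq> j \<Longrightarrow> z \<in> D \<Longrightarrow> 0 < B i j z"
    and B_sym: "\<And>i j z. i \<noteq> j \<Longrightarrow> z \<in> D \<Longrightarrow> B i j z = B j i z"
    and a_pos: "\<And>i z. z \<in> D \<Longrightarrow> 0 < a i z"
    and sys: "\<And>i z. z \<in> D \<Longrightarrow> (\<Sum>j\<in>UNIV - {i}. B i j z * (x i z - x j z)) = r i z"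
    and constr: "\<And>z. z \<in> D \<Longrightarrow> (\<Sum>j\<in>UNIV. a j z * x j z) = 0"
  shows "smooth_on (x k) D"
proof -
  define A :: "'a \<Rightarrow> real^'n^'n" where
    "A = (\<lambda>z. \<chi> i j. (if i = j then (\<Sum>l\<in>UNIV - {i}. B i l z) else - B i j z) + a i z * a j z)"
  have A_mult: "(A z *v y) $ i = (\<Sum>j\<in>UNIV - {i}. B i j z * (y $ i - y $ j)) + a i z * (\<Sum>j\<in>UNIV. a j z * y $ j)"
    for z y i
  proof -
    have "(\<Sum>j\<in>UNIV. (if i = j then (\<Sum>l\<in>UNIV - {i}. B i l z) else - B i j z) * y $ j)
        = (\<Sum>l\<in>UNIV - {i}. B i l z) * y $ i + (\<Sum>j\<in>UNIV - {i}. - B i j z * y $ j)"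
      by (subst sum.remove[of UNIV i]) (auto intro!: sum.cong)
    then show ?thesis
      by (simp add: A_def matrix_vector_mult_def distrib_right sum.distrib sum_distrib_left
          sum_distrib_right right_diff_distrib sum_subtractf sum_negf mult.assoc)
  qed
  have det_nz: "det (A z) \<noteq> 0" if z: "z \<in> D" for z
  proof -
    have "y = 0" if y: "A z *v y = 0" for y
    proof -
      define C where "C = (\<lambda>i j. if i = j then 0 else B i j z)"
      have C_sym: "C i j = C j i" for i j
        using B_sym z by (simp add: C_def)
      have C: "(\<Sum>j\<in>UNIV - {i}. B i j z * (y $ i - y $ j)) = (\<Sum>j\<in>UNIV. C i j * (y $ i - y $ j))" for i
        by (rule sum.mono_neutral_cong_left) (auto simp: C_def)
      have row: "(\<Sum>j\<in>UNIV. C i j * (y $ i - y $ j)) + a i z * (\<Sum>j\<in>UNIV. a j z * y $ j) = 0" for i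
        using A_mult[of z y i] y C by simp
      (* Summing the rows removes the antisymmetric part, so the constraint holds on the kernel;
         a row in which y is maximal then forces y to be constant. *)
      have "(\<Sum>i\<in>UNIV. \<Sum>j\<in>UNIV. C i j * (y $ i - y $ j)) = - (\<Sum>j\<in>UNIV. \<Sum>i\<in>UNIV. C j i * (y $ j - y $ i))"
        by (subst sum.swap) (simp add: sum_negf[symmetric] C_sym algebra_simps)
      then have "(\<Sum>i\<in>UNIV. \<Sum>j\<in>UNIV. C i j * (y $ i - y $ j)) = 0"
        by simp
      moreover have "(\<Sum>i\<in>UNIV. (\<Sum>j\<in>UNIV. C i j * (y $ i - y $ j)) + a i z * (\<Sum>j\<in>UNIV. a j z * y $ j)) = 0"
        using row by simp
      ultimately have "(\<Sum>i\<in>UNIV. a i z) * (\<Sum>j\<in>UNIV. a j z * y $ j) = 0"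
        by (simp add: sum.distrib sum_distrib_right)
      moreover have a_sum: "(\<Sum>i\<in>UNIV. a i z) > 0"
        using a_pos z by (intro sum_pos) auto
      ultimately have ay: "(\<Sum>j\<in>UNIV. a j z * y $ j) = 0"
        by simp
      have "Max (range (($) y)) \<in> range (($) y)"
        by (intro Max_in) auto
      then obtain i where i: "y $ i = Max (range (($) y))"
        by (metis rangeE)
      have max: "y $ j \<le> y $ i" for j
        unfolding i by (intro Max_ge) auto
      have "C i j * (y $ i - y $ j) \<ge> 0" for j
        using B_pos[of i j z] z max[of j] by (auto simp: C_def intro!: mult_nonneg_nonneg intro: less_imp_le)
      moreover have "(\<Sum>j\<in>UNIV. C i j * (y $ i - y $ j)) = 0"
        using row[of i] ay by simp
      ultimately have zero: "C i j * (y $ i - y $ j) = 0" for j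
        by (simp add: sum_nonneg_eq_0_iff)
      have const: "y $ j = y $ i" for j
        using zero[of j] B_pos[of i j z] z by (cases "i = j") (auto simp: C_def)
      have "(\<Sum>j\<in>UNIV. a j z) * y $ i = (\<Sum>j\<in>UNIV. a j z * y $ j)"
        unfolding sum_distrib_right by (intro sum.cong refl) (metis const)
      then have "y $ i = 0"
        using ay a_sum by simp
      then show "y = 0"
        using a_sum const by (simp add: vec_eq_iff)
    qed
    then show ?thesis
      using matrix_left_invertible_ker[of "A z"] invertible_left_inverse[of "A z"] invertible_det_nz[of "A z"]
      by metis
  qed
  have sA: "smooth_on (\<lambda>z. A z $ i $ j) D" for i j
    unfolding A_def using a \<open>open D\<close>
    by (cases "i = j") (auto intro!: smooth_on_add smooth_on_diff smooth_on_sum smooth_on_mult B)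
  define R :: "'a \<Rightarrow> real^'n" where "R = (\<lambda>z. \<chi> i. r i z)"
  have "smooth_on (\<lambda>z. (\<chi> i j. if j = k then R z $ i else A z $ i $ j) $ i $ j) D" for i j
    using r[of i] sA[of i j] by (cases "j = k") (auto simp: R_def)
  then have smooth: "smooth_on (\<lambda>z. det (\<chi> i j. if j = k then R z $ i else A z $ i $ j) / det (A z)) D"
    by (intro smooth_on_divide smooth_on_det \<open>open D\<close> sA det_nz)
  have "det (\<chi> i j. if j = k then R z $ i else A z $ i $ j) / det (A z) = x k z" if z: "z \<in> D" for z
  proof -
    have "A z *v (\<chi> i. x i z) = R z"
      using sys[OF z] constr[OF z] by (simp add: vec_eq_iff A_mult R_def)
    then have "(\<chi> i. x i z) = (\<chi> k. det (\<chi> i j. if j = k then R z $ i else A z $ i $ j) / det (A z))"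
      using cramer[OF det_nz[OF z]] by blast
    then show ?thesis
      by (simp add: vec_eq_iff)
  qed
  from smooth_on_cong[OF \<open>open D\<close> this smooth] show ?thesis .
qed

section \<open>Thermodynamic functions along a flow\<close>

lemma smooth_fieldsD:
  assumes "open D" "smooth_fields D \<rho> v \<theta>"
  shows "smooth_on (\<lambda>y. \<rho> y $ i) D" "smooth_on (\<lambda>y. v y $ \<alpha>) D" "smooth_on \<theta> D"
    and "z \<in> D \<Longrightarrow> (\<rho> z, \<theta> z) \<in> states"
  using assms by (auto simp: smooth_fields_def intro: smooth_on_nth)

lemma smooth_on_state_function:
  fixes \<rho> :: "spacetime \<Rightarrow> real^'n::finite" and G :: "'n state \<Rightarrow> real"
  assumes "open D" "smooth_fields D \<rho> v \<theta>" "smooth_on G states"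
  shows "smooth_on (\<lambda>y. G (\<rho> y, \<theta> y)) D"
  using assms by (intro smooth_on_compose[OF _ assms(3)] smooth_on_Pair) (auto simp: smooth_fields_def)

lemma state_positive:
  assumes "(\<rho>, \<theta>) \<in> states"
  shows "0 < \<rho> $ i" "0 < \<theta>" "0 < total_mass (\<rho>, \<theta>)"
  using assms by (auto simp: states_def total_mass_def intro: sum_pos)

lemma frechet_state_function:
  fixes \<rho> :: "spacetime \<Rightarrow> real^'n::finite" and G :: "'n state \<Rightarrow> real"
  assumes "G differentiable (at (\<rho> z, \<theta> z))" "\<rho> differentiable (at z)" "\<theta> differentiable (at z)"
  shows "frechet_derivative (\<lambda>y. G (\<rho> y, \<theta> y)) (at z) h = frechet_derivative G (at (\<rho> z, \<theta> z))
    (\<chi> i. frechet_derivative (\<lambda>y. \<rho> y $ i) (at z) h, frechet_derivative \<theta> (at z) h)"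
proof -
  note d\<rho> = differentiable_frechet[OF assms(2)]
  note d\<theta> = differentiable_frechet[OF assms(3)]
  have "(\<chi> i. frechet_derivative (\<lambda>y. \<rho> y $ i) (at z) h) = frechet_derivative \<rho> (at z) h"
    by (simp add: vec_eq_iff frechet_eq[OF bounded_linear.has_derivative[OF bounded_linear_vec_nth d\<rho>]])
  then show ?thesis
    using frechet_eq[OF has_derivative_compose[OF has_derivative_Pair[OF d\<rho> d\<theta>] differentiable_frechet[OF assms(1)]]]
    by simp
qed

context
  fixes D and F :: "'n::finite state \<Rightarrow> real" and \<rho> :: "spacetime \<Rightarrow> real^'n::finite" and v \<theta> z
  assumes op: "open D" and z: "z \<in> D" and F: "smooth_on F states" and fields: "smooth_fields D \<rho> v \<theta>"
begin

lemma differentiable_fields: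
  shows "(\<lambda>y. \<rho> y $ i) differentiable (at z)" "(\<lambda>y. v y $ \<alpha>) differentiable (at z)"
    "\<theta> differentiable (at z)" "v differentiable (at z)" "\<rho> differentiable (at z)"
  using smooth_fieldsD[OF op fields] z fields
  by (auto intro: smooth_on_differentiable simp: smooth_fields_def)

lemma differentiable_state_function:
  fixes G :: "'n state \<Rightarrow> real"
  shows "smooth_on G states \<Longrightarrow> (\<lambda>y. G (\<rho> y, \<theta> y)) differentiable (at z)"
  using smooth_on_state_function[OF op fields] z by (auto intro: smooth_on_differentiable)

lemma differentiable_total_mass: "(\<lambda>y. total_mass (\<rho> y, \<theta> y)) differentiable (at z)"
  unfolding total_mass_def using differentiable_fields by simp

lemma state_in_states: "(\<rho> z, \<theta> z) \<in> states"
  using smooth_fieldsD[OF op fields] z by blast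

lemma frechet_total_mass:
  "frechet_derivative (\<lambda>y. total_mass (\<rho> y, \<theta> y)) (at z) h
    = (\<Sum>i\<in>UNIV. frechet_derivative (\<lambda>y. \<rho> y $ i) (at z) h)"
  unfolding total_mass_def using differentiable_fields by (simp add: frechet_sum)

lemma chain_rule:
  fixes G :: "'n state \<Rightarrow> real"
  assumes "smooth_on G states"
  shows "frechet_derivative (\<lambda>y. G (\<rho> y, \<theta> y)) (at z) h
    = (\<Sum>j\<in>UNIV. d_rho j G (\<rho> z, \<theta> z) * frechet_derivative (\<lambda>y. \<rho> y $ j) (at z) h)
      + d_theta G (\<rho> z, \<theta> z) * frechet_derivative \<theta> (at z) h"
  using differentiable_fields smooth_on_differentiable[OF assms state_in_states]
  by (simp add: frechet_state_function frechet_state)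

lemma gibbs_energy_flow:
  "frechet_derivative (\<lambda>y. energy_dens F (\<rho> y, \<theta> y)) (at z) h
    = (\<Sum>i\<in>UNIV. chem_pot F i (\<rho> z, \<theta> z) * frechet_derivative (\<lambda>y. \<rho> y $ i) (at z) h)
      + \<theta> z * frechet_derivative (\<lambda>y. entropy_dens F (\<rho> y, \<theta> y)) (at z) h"
  using differentiable_fields
  by (simp add: frechet_state_function gibbs_energy[OF F state_in_states]
      smooth_on_differentiable[OF _ state_in_states] smooth_on_energy_dens smooth_on_entropy_dens F)

lemma gibbs_duhem_flow:
  "frechet_derivative (\<lambda>y. pressure F (\<rho> y, \<theta> y)) (at z) h
    = (\<Sum>i\<in>UNIV. \<rho> z $ i * frechet_derivative (\<lambda>y. chem_pot F i (\<rho> y, \<theta> y)) (at z) h)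
      + entropy_dens F (\<rho> z, \<theta> z) * frechet_derivative \<theta> (at z) h"
  using differentiable_fields
  by (simp add: frechet_state_function gibbs_duhem[OF F state_in_states]
      smooth_on_differentiable[OF _ state_in_states] smooth_on_pressure smooth_on_chem_pot F)

end

lemma euler_relation:
  "energy_dens F (\<rho>, \<theta>) + pressure F (\<rho>, \<theta>)
    = (\<Sum>i\<in>UNIV. \<rho> $ i * chem_pot F i (\<rho>, \<theta>)) + \<theta> * entropy_dens F (\<rho>, \<theta>)"
  by (simp add: energy_dens_def pressure_def)


section \<open>Balance laws in convective form\<close>

text \<open>One set of hypotheses serves both systems. For the diffusive one \<open>s\<^sub>i\<close> is the divergence of
  \<open>\<rho>\<^sub>i u\<^sub>i\<close> and \<open>r\<close> the divergence of \<open>\<kappa>\<nabla>\<theta> - \<Sum>\<^sub>j h\<^sub>j u\<^sub>j\<close>; for the nondiffusive one \<open>s = 0\<close> and \<open>r\<close> is the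
  divergence of \<open>\<kappa>\<nabla>\<theta>\<close>.\<close>

context
  fixes D and F :: "'n::finite state \<Rightarrow> real" and \<rho> :: "spacetime \<Rightarrow> real^'n::finite" and v \<theta> z s r
  assumes op: "open D" and z: "z \<in> D" and F: "smooth_on F states" and fields: "smooth_fields D \<rho> v \<theta>"
    and mass: "\<And>i. dt (\<lambda>y. \<rho> y $ i) z + divg (\<lambda>y. (\<rho> y $ i) *\<^sub>R v y) z = - s i"
    and sum_s: "(\<Sum>i\<in>UNIV. s i) = 0"
    and momentum: "dt (\<lambda>y. total_mass (\<rho> y, \<theta> y) *\<^sub>R v y) z
      + div_tensor (\<lambda>y. total_mass (\<rho> y, \<theta> y) *\<^sub>R outer (v y) (v y) + pressure F (\<rho> y, \<theta> y) *\<^sub>R mat 1) z = 0"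
    and energy: "dt (\<lambda>y. energy_dens F (\<rho> y, \<theta> y) + 1/2 * total_mass (\<rho> y, \<theta> y) * (norm (v y))\<^sup>2) z
      + divg (\<lambda>y. (energy_dens F (\<rho> y, \<theta> y) + 1/2 * total_mass (\<rho> y, \<theta> y) * (norm (v y))\<^sup>2) *\<^sub>R v y
                + pressure F (\<rho> y, \<theta> y) *\<^sub>R v y) z = r"
begin

private abbreviation "m \<equiv> \<lambda>y. total_mass (\<rho> y, \<theta> y)"
private abbreviation "p \<equiv> \<lambda>y. pressure F (\<rho> y, \<theta> y)"
private abbreviation "E \<equiv> \<lambda>y. energy_dens F (\<rho> y, \<theta> y)"
private abbreviation "H \<equiv> \<lambda>y. entropy_dens F (\<rho> y, \<theta> y)"
private abbreviation "\<mu> \<equiv> \<lambda>i y. chem_pot F i (\<rho> y, \<theta> y)"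
private abbreviation "Dt \<equiv> \<lambda>f. frechet_derivative f (at z) (1, v z)"

private lemmas diff = differentiable_fields[OF op z F fields] differentiable_total_mass[OF op z F fields]
  differentiable_state_function[OF op z F fields smooth_on_pressure[OF F]]
  differentiable_state_function[OF op z F fields smooth_on_energy_dens[OF F]]
  differentiable_state_function[OF op z F fields smooth_on_entropy_dens[OF F]]

private lemma transport:
  assumes "f differentiable (at z)"
  shows "dt f z + divg (\<lambda>y. f y *\<^sub>R v y) z = Dt f + f z * divg v z"
  using assms diff by (simp add: divg_scaleR material_derivative[symmetric])

lemma mass_convective: "Dt (\<lambda>y. \<rho> y $ i) = - \<rho> z $ i * divg v z - s i"
  using mass[of i] transport[of "\<lambda>y. \<rho> y $ i"] diff by simp

lemma total_mass_convective: "Dt m = - m z * divg v z"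
  unfolding frechet_total_mass[OF op z F fields] mass_convective
  by (simp add: sum_subtractf sum_s sum_negf sum_distrib_right total_mass_def)

lemma velocity_convective: "m z * Dt (\<lambda>y. v y $ \<beta>) = - grad p z $ \<beta>"
proof -
  have mv: "(\<lambda>y. m y *\<^sub>R v y) differentiable (at z)"
    using diff by simp
  have "dt (\<lambda>y. m y *\<^sub>R v y) z $ \<beta> = dt (\<lambda>y. m y * v y $ \<beta>) z"
    using frechet_eq[OF bounded_linear.has_derivative[OF bounded_linear_vec_nth differentiable_frechet[OF mv], of \<beta>]]
      mv diff by (simp add: dt_eq)
  moreover have "div_tensor (\<lambda>y. m y *\<^sub>R outer (v y) (v y) + p y *\<^sub>R mat 1) z $ \<beta>
    = divg (\<lambda>y. (m y * v y $ \<beta>) *\<^sub>R v y) z + grad p z $ \<beta>"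
    using diff by (intro div_tensor_flux)
  ultimately have "Dt (\<lambda>y. m y * v y $ \<beta>) + m z * v z $ \<beta> * divg v z + grad p z $ \<beta> = 0"
    using arg_cong[OF momentum, of "\<lambda>w. w $ \<beta>"] transport[of "\<lambda>y. m y * v y $ \<beta>"] diff by simp
  moreover have "Dt (\<lambda>y. m y * v y $ \<beta>) = - m z * divg v z * v z $ \<beta> + m z * Dt (\<lambda>y. v y $ \<beta>)"
    using diff total_mass_convective by (simp add: frechet_mult)
  ultimately show ?thesis
    by (simp add: algebra_simps)
qed

text \<open>Subtracting from the total energy balance the momentum balance tested with \<open>v\<close> leaves the
  internal energy balance; the Gibbs relation turns this into a balance of entropy.\<close>

lemma entropy_convective: "\<theta> z * (Dt H + H z * divg v z) = r + (\<Sum>i\<in>UNIV. \<mu> i z * s i)"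
proof -
  have norm_sq: "(norm (v y))\<^sup>2 = (\<Sum>\<beta>\<in>UNIV. v y $ \<beta> * v y $ \<beta>)" for y
    by (simp add: power2_norm_eq_inner inner_vec_def)
  define K where "K y = 1/2 * m y * (\<Sum>\<beta>\<in>UNIV. v y $ \<beta> * v y $ \<beta>)" for y
  have K_diff: "K differentiable (at z)"
    unfolding K_def using diff by simp
  have EK: "(\<lambda>y. E y + K y) differentiable (at z)"
    using diff K_diff by simp
  have "Dt (\<lambda>y. E y + K y) + (E z + K z) * divg v z + (v z \<bullet> grad p z + p z * divg v z) = r"
    using energy[unfolded norm_sq, folded K_def] diff EK transport[OF EK]
    by (simp add: divg_add divg_scaleR)
  moreover have "Dt K + K z * divg v z = - (v z \<bullet> grad p z)"
  proof -
    have "Dt K = 1/2 * Dt m * (\<Sum>\<beta>\<in>UNIV. v z $ \<beta> * v z $ \<beta>)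
        + 1/2 * m z * (\<Sum>\<beta>\<in>UNIV. Dt (\<lambda>y. v y $ \<beta>) * v z $ \<beta> + v z $ \<beta> * Dt (\<lambda>y. v y $ \<beta>))"
      unfolding K_def using diff by (simp add: frechet_mult frechet_divide frechet_sum algebra_simps)
    also have "\<dots> = - K z * divg v z + (\<Sum>\<beta>\<in>UNIV. v z $ \<beta> * (m z * Dt (\<lambda>y. v y $ \<beta>)))"
      by (simp add: total_mass_convective K_def sum_distrib_left algebra_simps)
    also have "(\<Sum>\<beta>\<in>UNIV. v z $ \<beta> * (m z * Dt (\<lambda>y. v y $ \<beta>))) = - (v z \<bullet> grad p z)"
      unfolding velocity_convective by (simp add: inner_vec_def sum_negf)
    finally show ?thesis by simp
  qed
  ultimately have "Dt E + (E z + p z) * divg v z = r"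
    using diff K_diff by (simp add: frechet_add algebra_simps)
  moreover have "Dt E = (\<Sum>i\<in>UNIV. \<mu> i z * (- \<rho> z $ i * divg v z - s i)) + \<theta> z * Dt H"
    by (simp add: gibbs_energy_flow[OF op z F fields] mass_convective)
  ultimately show ?thesis
    by (simp add: euler_relation algebra_simps sum_subtractf sum_negf sum_distrib_left sum.distrib)
qed

end

section \<open>The diffusive terms\<close>

lemma smooth_on_driving_force:
  fixes \<rho> :: "spacetime \<Rightarrow> real^'n::finite"
  assumes "open D" "smooth_fields D \<rho> v \<theta>" "smooth_on F states"
    and "\<And>i. smooth_on (e i) states" "\<And>i. smooth_on (q i) states"
  shows "smooth_on (\<lambda>z. driving_force F e q \<rho> \<theta> i z $ \<alpha>) D"
proof -
  note fields = smooth_fieldsD[OF assms(1,2)]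
  note comp = smooth_on_state_function[OF assms(1,2)]
  have pos: "\<theta> z \<noteq> 0" "total_mass (\<rho> z, \<theta> z) \<noteq> 0" if "z \<in> D" for z
    using state_positive[OF fields(4)[OF that]] by auto
  have m: "smooth_on (\<lambda>z. total_mass (\<rho> z, \<theta> z)) D"
    unfolding total_mass_def fst_conv by (intro smooth_on_sum fields assms(1))
  have h: "smooth_on (\<lambda>z. enthalpy e q i (\<rho> z, \<theta> z)) D"
    unfolding enthalpy_def fst_conv
    by (intro smooth_on_add smooth_on_mult fields assms(1) comp assms(4,5))
  have "smooth_on (\<lambda>z. - (\<rho> z $ i / total_mass (\<rho> z, \<theta> z)) * dx \<alpha> (\<lambda>y. pressure F (\<rho> y, \<theta> y)) z
     + (\<rho> z $ i * \<theta> z) * dx \<alpha> (\<lambda>y. chem_pot F i (\<rho> y, \<theta> y) / \<theta> y) z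
     - (\<theta> z * enthalpy e q i (\<rho> z, \<theta> z)) * dx \<alpha> (\<lambda>y. 1 / \<theta> y) z) D"
    by (intro smooth_on_add smooth_on_diff smooth_on_minus smooth_on_mult smooth_on_divide smooth_on_dx
        smooth_on_const fields comp m h assms(1) smooth_on_pressure smooth_on_chem_pot assms(3) pos)
  then show ?thesis
    by (simp add: driving_force_def grad_nth)
qed

text \<open>The velocities \<open>u\<^sub>i\<close> come without any regularity hypothesis. Each of their components solves a
  constrained linear system whose coefficients and right-hand sides are smooth functions of the
  fields and of their first derivatives, and \<open>constrained_laplacian_solution_smooth\<close> applies.\<close>

lemma diffusional_velocity_differentiable:
  fixes \<rho> :: "spacetime \<Rightarrow> real^'n::finite"
  assumes "open D" "constitutive F e q \<kappa> b" "diffusive_solution D F e q \<kappa> b \<epsilon> \<rho> v \<theta> u" "z \<in> D"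
  shows "u i differentiable (at z)"
proof (rule differentiable_vecI)
  fix \<alpha>
  have flds: "smooth_fields D \<rho> v \<theta>"
    using assms(3) by (simp add: diffusive_solution_def)
  note fields = smooth_fieldsD[OF assms(1) flds]
  have pos: "0 < \<rho> z $ i" "0 < \<theta> z" if "z \<in> D" for z i
    using state_positive[OF fields(4)[OF that]] by auto
  have b_smooth: "smooth_on (b i j) ({0<..} \<times> {0<..} \<times> {0<..})" if "i \<noteq> j" for i j
    using assms(2) that by (simp add: constitutive_def)
  have b_pos: "0 < b i j (r, s, \<tau>)" and b_sym: "b i j (r, s, \<tau>) = b j i (s, r, \<tau>)"
    if "i \<noteq> j" "0 < r" "0 < s" "0 < \<tau>" for i j r s \<tau>
    using assms(2) that unfolding constitutive_def by blast+
  have "smooth_on (\<lambda>z. u i z $ \<alpha>) D"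
  proof (rule constrained_laplacian_solution_smooth[where x = "\<lambda>i z. u i z $ \<alpha>" and a = "\<lambda>i z. \<rho> z $ i"
        and B = "\<lambda>i j z. b i j (\<rho> z $ i, \<rho> z $ j, \<theta> z) * \<theta> z * \<rho> z $ i * \<rho> z $ j"
        and r = "\<lambda>i z. - \<epsilon> * driving_force F e q \<rho> \<theta> i z $ \<alpha>"])
    show "smooth_on (\<lambda>z. b i j (\<rho> z $ i, \<rho> z $ j, \<theta> z) * \<theta> z * \<rho> z $ i * \<rho> z $ j) D" if "i \<noteq> j" for i j
      by (intro smooth_on_mult fields assms(1) smooth_on_compose[OF _ b_smooth[OF that]] smooth_on_Pair)
        (simp add: pos)
    show "smooth_on (\<lambda>z. - \<epsilon> * driving_force F e q \<rho> \<theta> i z $ \<alpha>) D" for i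
      using assms(2)
      by (intro smooth_on_mult smooth_on_const assms(1) smooth_on_driving_force[OF assms(1) flds])
        (auto simp: constitutive_def)
    show "0 < b i j (\<rho> z $ i, \<rho> z $ j, \<theta> z) * \<theta> z * \<rho> z $ i * \<rho> z $ j" if "i \<noteq> j" "z \<in> D" for i j z
      using that pos b_pos by simp
    show "b i j (\<rho> z $ i, \<rho> z $ j, \<theta> z) * \<theta> z * \<rho> z $ i * \<rho> z $ j
        = b j i (\<rho> z $ j, \<rho> z $ i, \<theta> z) * \<theta> z * \<rho> z $ j * \<rho> z $ i" if "i \<noteq> j" "z \<in> D" for i j z
      using b_sym[OF that(1) pos(1)[OF that(2)] pos(1)[OF that(2)] pos(2)[OF that(2)]] by simp
    show "(\<Sum>j\<in>UNIV - {i}. b i j (\<rho> z $ i, \<rho> z $ j, \<theta> z) * \<theta> z * \<rho> z $ i * \<rho> z $ j * (u i z $ \<alpha> - u j z $ \<alpha>))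
        = - \<epsilon> * driving_force F e q \<rho> \<theta> i z $ \<alpha>" if "z \<in> D" for i z
    proof -
      have "- (\<Sum>j\<in>UNIV - {i}. (b i j (\<rho> z $ i, \<rho> z $ j, \<theta> z) * \<theta> z * \<rho> z $ i * \<rho> z $ j) *\<^sub>R (u i z - u j z))
          = \<epsilon> *\<^sub>R driving_force F e q \<rho> \<theta> i z"
        using assms(3) that by (simp add: diffusive_solution_def Let_def)
      from arg_cong[OF this, of "\<lambda>w. - (w $ \<alpha>)"] show ?thesis
        by simp
    qed
    show "(\<Sum>j\<in>UNIV. \<rho> z $ j * u j z $ \<alpha>) = 0" if "z \<in> D" for z
    proof -
      have "(\<Sum>j\<in>UNIV. (\<rho> z $ j) *\<^sub>R u j z) = 0"
        using assms(3) that by (simp add: diffusive_solution_def Let_def)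
      from arg_cong[OF this, of "\<lambda>w. w $ \<alpha>"] show ?thesis
        by simp
    qed
  qed (use assms(1) fields pos in auto)
  then show "(\<lambda>y. u i y $ \<alpha>) differentiable (at z)"
    using assms(4) by (rule smooth_on_differentiable)
qed

context
  fixes \<rho> \<mu> \<mu>' h :: "'n::finite \<Rightarrow> spacetime \<Rightarrow> real" and u :: "'n \<Rightarrow> spacetime \<Rightarrow> real^3"
    and \<theta> \<theta>' k k' :: "spacetime \<Rightarrow> real" and z :: spacetime
  assumes diff: "\<And>j. \<rho> j differentiable (at z)" "\<And>j. \<mu> j differentiable (at z)"
    "\<And>j. \<mu>' j differentiable (at z)" "\<And>j. h j differentiable (at z)" "\<And>j. u j differentiable (at z)"
    "\<theta> differentiable (at z)" "\<theta>' differentiable (at z)" "k differentiable (at z)" "k' differentiable (at z)"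
    "grad \<theta> differentiable (at z)" "grad \<theta>' differentiable (at z)"
    and pos: "\<theta> z > 0" "\<theta>' z > 0"
    and constraint: "(\<Sum>j\<in>UNIV. \<rho> j z *\<^sub>R u j z) = 0"
begin

text \<open>The common vector \<open>P\<close>, which stands for the pressure gradient, is tested with \<open>\<Sum>\<^sub>j \<rho>\<^sub>j u\<^sub>j = 0\<close>. The
  gradients of \<open>\<mu>\<^sub>j/\<theta>\<close> and \<open>1/\<theta>\<close> contribute \<open>-\<rho>\<^sub>j \<mu>\<^sub>j\<close> and \<open>h\<^sub>j\<close> to the factor of \<open>\<nabla>\<theta>/\<theta>\<close>.\<close>

lemma diffusive_dissipation:
  "(\<Sum>j\<in>UNIV. u j z \<bullet> (- (\<rho> j z / m) *\<^sub>R P + (\<rho> j z * \<theta> z) *\<^sub>R grad (\<lambda>y. \<mu> j y / \<theta> y) z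
        - (\<theta> z * h j z) *\<^sub>R grad (\<lambda>y. 1 / \<theta> y) z))
    = (\<Sum>j\<in>UNIV. \<rho> j z * (u j z \<bullet> grad (\<mu> j) z))
      + 1 / \<theta> z * ((\<Sum>j\<in>UNIV. (h j z - \<rho> j z * \<mu> j z) *\<^sub>R u j z) \<bullet> grad \<theta> z)"
proof -
  have "u j z \<bullet> (- (\<rho> j z / m) *\<^sub>R P + (\<rho> j z * \<theta> z) *\<^sub>R grad (\<lambda>y. \<mu> j y / \<theta> y) z
        - (\<theta> z * h j z) *\<^sub>R grad (\<lambda>y. 1 / \<theta> y) z)
     = - (1 / m) * ((\<rho> j z *\<^sub>R u j z) \<bullet> P) + (\<rho> j z * (u j z \<bullet> grad (\<mu> j) z)
       + 1 / \<theta> z * (((h j z - \<rho> j z * \<mu> j z) *\<^sub>R u j z) \<bullet> grad \<theta> z))" for j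
    using diff pos
    by (simp add: grad_divide grad_const inner_diff_right inner_add_right inner_diff_left power2_eq_square
        field_simps)
  moreover have "(\<Sum>j\<in>UNIV. - (1 / m) * ((\<rho> j z *\<^sub>R u j z) \<bullet> P)) = 0"
    unfolding sum_distrib_left[symmetric] inner_sum_left[symmetric] constraint by simp
  ultimately show ?thesis
    by (simp only: sum.distrib sum_distrib_left[symmetric] inner_sum_left[symmetric])
qed

lemma diffusive_flux_divergence:
  "divg (\<lambda>y. (\<Sum>j\<in>UNIV. (\<rho> j y * (\<mu> j y - \<mu>' j y)) *\<^sub>R u j y)) z
   = (\<Sum>j\<in>UNIV. \<rho> j z * (u j z \<bullet> grad (\<mu> j) z)) - (\<Sum>j\<in>UNIV. \<rho> j z * (u j z \<bullet> grad (\<mu>' j) z))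
     + (\<Sum>j\<in>UNIV. (\<mu> j z - \<mu>' j z) * divg (\<lambda>y. \<rho> j y *\<^sub>R u j y) z)"
proof -
  have "(\<lambda>y. (\<rho> j y * (\<mu> j y - \<mu>' j y)) *\<^sub>R u j y) = (\<lambda>y. (\<mu> j y - \<mu>' j y) *\<^sub>R (\<rho> j y *\<^sub>R u j y))" for j
    by (simp add: mult.commute)
  then show ?thesis
    using diff
    by (simp add: divg_sum divg_scaleR[of "\<lambda>y. \<mu> j y - \<mu>' j y" z "\<lambda>y. \<rho> j y *\<^sub>R u j y" for j] grad_diff
        inner_diff_right right_diff_distrib sum.distrib sum_subtractf del: scaleR_scaleR)
qed

lemma heat_flux_divergence:
  "divg (\<lambda>y. (\<theta> y - \<theta>' y) *\<^sub>R ((1 / \<theta> y * k y) *\<^sub>R grad \<theta> y - (1 / \<theta>' y * k' y) *\<^sub>R grad \<theta>' y)) z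
   = (k z / \<theta> z) * (grad \<theta> z \<bullet> grad \<theta> z - grad \<theta> z \<bullet> grad \<theta>' z)
     - (k' z / \<theta>' z) * (grad \<theta> z \<bullet> grad \<theta>' z - grad \<theta>' z \<bullet> grad \<theta>' z)
     + (\<theta> z - \<theta>' z) * (divg (\<lambda>y. k y *\<^sub>R grad \<theta> y) z / \<theta> z - k z * (grad \<theta> z \<bullet> grad \<theta> z) / (\<theta> z)\<^sup>2
         - divg (\<lambda>y. k' y *\<^sub>R grad \<theta>' y) z / \<theta>' z + k' z * (grad \<theta>' z \<bullet> grad \<theta>' z) / (\<theta>' z)\<^sup>2)"
proof -
  have split: "divg (\<lambda>y. (1 / \<tau> y * c y) *\<^sub>R grad \<tau> y) z
      = divg (\<lambda>y. c y *\<^sub>R grad \<tau> y) z / \<tau> z - c z * (grad \<tau> z \<bullet> grad \<tau> z) / (\<tau> z)\<^sup>2"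
    if "c differentiable (at z)" "\<tau> differentiable (at z)" "grad \<tau> differentiable (at z)" "\<tau> z > 0" for c \<tau>
    using that divg_scaleR[of "\<lambda>y. 1 / \<tau> y" z "\<lambda>y. c y *\<^sub>R grad \<tau> y"]
    by (simp add: grad_divide grad_const)
  have dq: "(\<lambda>y. (1 / \<theta> y * k y) *\<^sub>R grad \<theta> y) differentiable (at z)"
    "(\<lambda>y. (1 / \<theta>' y * k' y) *\<^sub>R grad \<theta>' y) differentiable (at z)"
    using diff pos by (auto intro!: differentiable_scaleR differentiable_mult differentiable_divide)
  then have "divg (\<lambda>y. (\<theta> y - \<theta>' y) *\<^sub>R ((1 / \<theta> y * k y) *\<^sub>R grad \<theta> y - (1 / \<theta>' y * k' y) *\<^sub>R grad \<theta>' y)) z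
    = ((1 / \<theta> z * k z) *\<^sub>R grad \<theta> z - (1 / \<theta>' z * k' z) *\<^sub>R grad \<theta>' z) \<bullet> (grad \<theta> z - grad \<theta>' z)
      + (\<theta> z - \<theta>' z) * (divg (\<lambda>y. (1 / \<theta> y * k y) *\<^sub>R grad \<theta> y) z - divg (\<lambda>y. (1 / \<theta>' y * k' y) *\<^sub>R grad \<theta>' y) z)"
    using diff by (simp only: divg_scaleR divg_diff grad_diff differentiable_diff)
  then show ?thesis
    unfolding split[OF diff(8,6,10) pos(1)] split[OF diff(9,7,11) pos(2)]
    by (simp add: inner_diff_left inner_diff_right inner_commute algebra_simps)
qed

lemma enthalpy_flux_divergence:
  "divg (\<lambda>y. (1 / \<theta> y * (\<theta> y - \<theta>' y)) *\<^sub>R (\<Sum>j\<in>UNIV. (h j y - \<rho> j y * \<mu> j y) *\<^sub>R u j y)) z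
   = (\<theta>' z / (\<theta> z)\<^sup>2) * ((\<Sum>j\<in>UNIV. (h j z - \<rho> j z * \<mu> j z) *\<^sub>R u j z) \<bullet> grad \<theta> z)
     - (1 / \<theta> z) * ((\<Sum>j\<in>UNIV. (h j z - \<rho> j z * \<mu> j z) *\<^sub>R u j z) \<bullet> grad \<theta>' z)
     + (1 - \<theta>' z / \<theta> z) * (divg (\<lambda>y. \<Sum>j\<in>UNIV. h j y *\<^sub>R u j y) z
         - (\<Sum>j\<in>UNIV. \<rho> j z * (u j z \<bullet> grad (\<mu> j) z))
         - (\<Sum>j\<in>UNIV. \<mu> j z * divg (\<lambda>y. \<rho> j y *\<^sub>R u j y) z))"
proof -
  let ?V = "\<lambda>y. \<Sum>j\<in>UNIV. (h j y - \<rho> j y * \<mu> j y) *\<^sub>R u j y"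
  have V: "?V = (\<lambda>y. (\<Sum>j\<in>UNIV. h j y *\<^sub>R u j y) - (\<Sum>j\<in>UNIV. \<mu> j y *\<^sub>R (\<rho> j y *\<^sub>R u j y)))"
    by (simp add: scaleR_diff_left sum_subtractf mult.commute)
  have d\<rho>u: "(\<lambda>y. \<rho> j y *\<^sub>R u j y) differentiable (at z)" for j
    using diff by simp
  have dV: "?V differentiable (at z)"
    using diff by simp
  have "divg ?V z = divg (\<lambda>y. \<Sum>j\<in>UNIV. h j y *\<^sub>R u j y) z
      - (\<Sum>j\<in>UNIV. divg (\<lambda>y. \<mu> j y *\<^sub>R (\<rho> j y *\<^sub>R u j y)) z)"
    unfolding V using diff d\<rho>u by (simp add: divg_diff divg_sum del: scaleR_scaleR)
  also have "(\<Sum>j\<in>UNIV. divg (\<lambda>y. \<mu> j y *\<^sub>R (\<rho> j y *\<^sub>R u j y)) z)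
      = (\<Sum>j\<in>UNIV. \<rho> j z * (u j z \<bullet> grad (\<mu> j) z)) + (\<Sum>j\<in>UNIV. \<mu> j z * divg (\<lambda>y. \<rho> j y *\<^sub>R u j y) z)"
    using diff d\<rho>u divg_scaleR[OF diff(2) d\<rho>u] by (simp add: sum.distrib del: scaleR_scaleR)
  finally have div_V: "divg ?V z = divg (\<lambda>y. \<Sum>j\<in>UNIV. h j y *\<^sub>R u j y) z
      - (\<Sum>j\<in>UNIV. \<rho> j z * (u j z \<bullet> grad (\<mu> j) z))
      - (\<Sum>j\<in>UNIV. \<mu> j z * divg (\<lambda>y. \<rho> j y *\<^sub>R u j y) z)"
    by simp
  have da: "(\<lambda>y. 1 / \<theta> y * (\<theta> y - \<theta>' y)) differentiable (at z)"
    using diff pos by (auto intro!: differentiable_mult differentiable_divide differentiable_diff)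
  have d1: "(\<lambda>y. 1 / \<theta> y) differentiable (at z)"
    using diff pos by (auto intro!: differentiable_divide)
  have "grad (\<lambda>y. 1 / \<theta> y * (\<theta> y - \<theta>' y)) z = (\<theta>' z / (\<theta> z)\<^sup>2) *\<^sub>R grad \<theta> z - (1 / \<theta> z) *\<^sub>R grad \<theta>' z"
    using diff pos grad_mult[OF d1 differentiable_diff[OF diff(6,7)]]
    by (simp add: grad_diff grad_divide grad_const vec_eq_iff field_simps power2_eq_square)
  moreover have "1 / \<theta> z * (\<theta> z - \<theta>' z) = 1 - \<theta>' z / \<theta> z"
    using pos by (simp add: field_simps)
  ultimately show ?thesis
    unfolding divg_scaleR[OF da dV] div_V by (simp add: inner_diff_right)
qed

text \<open>All second order terms cancel: the divergences of \<open>\<kappa>\<nabla>\<theta>\<close>, \<open>\<kappa>'\<nabla>\<theta>'\<close>, \<open>h\<^sub>j u\<^sub>j\<close> and \<open>\<rho>\<^sub>j u\<^sub>j\<close>. What is left is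
  quadratic in the \<open>u\<^sub>j\<close> and the gradients. There \<open>1 - \<theta>'/\<theta>\<close> has the gradient
  \<open>(\<theta>'/\<theta>) (\<nabla>\<theta>/\<theta> - \<nabla>\<theta>'/\<theta>')\<close>; its first part cancels the temperature part of the dissipation and its
  second part is the last term on the right, with the coefficient \<open>1/\<theta>\<close>.\<close>

lemma diffusive_identity:
  assumes V: "V = (\<Sum>j\<in>UNIV. (h j z - \<rho> j z * \<mu> j z) *\<^sub>R u j z)"
    and s: "\<And>j. s j = divg (\<lambda>y. \<rho> j y *\<^sub>R u j y) z"
  shows "divg (\<lambda>y. (\<Sum>j\<in>UNIV. (\<rho> j y * (\<mu> j y - \<mu>' j y)) *\<^sub>R u j y)) z
    - divg (\<lambda>y. (\<theta> y - \<theta>' y) *\<^sub>R ((1 / \<theta> y * k y) *\<^sub>R grad \<theta> y - (1 / \<theta>' y * k' y) *\<^sub>R grad \<theta>' y)) z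
    + divg (\<lambda>y. (1 / \<theta> y * (\<theta> y - \<theta>' y)) *\<^sub>R (\<Sum>j\<in>UNIV. (h j y - \<rho> j y * \<mu> j y) *\<^sub>R u j y)) z
    + (\<theta> z - \<theta>' z) / \<theta> z * (divg (\<lambda>y. k y *\<^sub>R grad \<theta> y) z - divg (\<lambda>y. \<Sum>j\<in>UNIV. h j y *\<^sub>R u j y) z
        + (\<Sum>j\<in>UNIV. \<mu> j z * s j))
    - (\<Sum>j\<in>UNIV. (\<mu> j z - \<mu>' j z) * s j)
    - (\<theta> z - \<theta>' z) / \<theta>' z * divg (\<lambda>y. k' y *\<^sub>R grad \<theta>' y) z
    + \<theta>' z * k z * (norm (grad \<theta> z /\<^sub>R \<theta> z - grad \<theta>' z /\<^sub>R \<theta>' z))\<^sup>2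
    - \<theta>' z / \<theta> z * ((\<Sum>j\<in>UNIV. \<rho> j z * (u j z \<bullet> grad (\<mu> j) z)) + 1 / \<theta> z * (V \<bullet> grad \<theta> z))
    = - (\<Sum>j\<in>UNIV. \<rho> j z * (u j z \<bullet> grad (\<mu>' j) z))
      - ((grad \<theta> z /\<^sub>R \<theta> z - grad \<theta>' z /\<^sub>R \<theta>' z) \<bullet> (grad \<theta>' z /\<^sub>R \<theta>' z)) * (\<theta>' z * k z - \<theta> z * k' z)
      - 1 / \<theta> z * (V \<bullet> grad \<theta>' z)"
proof -
  have sums: "(\<Sum>j\<in>UNIV. (\<mu> j z - \<mu>' j z) * s j) = (\<Sum>j\<in>UNIV. \<mu> j z * s j) - (\<Sum>j\<in>UNIV. \<mu>' j z * s j)"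
    by (simp add: left_diff_distrib sum_subtractf)
  have norm_sq: "(norm (grad \<theta> z /\<^sub>R \<theta> z - grad \<theta>' z /\<^sub>R \<theta>' z))\<^sup>2
      = (grad \<theta> z \<bullet> grad \<theta> z) / (\<theta> z)\<^sup>2 - 2 * (grad \<theta> z \<bullet> grad \<theta>' z) / (\<theta> z * \<theta>' z)
        + (grad \<theta>' z \<bullet> grad \<theta>' z) / (\<theta>' z)\<^sup>2"
    unfolding power2_norm_eq_inner
    by (simp add: inner_diff_left inner_diff_right inner_commute power2_eq_square divide_inverse algebra_simps)
  have inner: "(grad \<theta> z /\<^sub>R \<theta> z - grad \<theta>' z /\<^sub>R \<theta>' z) \<bullet> (grad \<theta>' z /\<^sub>R \<theta>' z)
      = (grad \<theta> z \<bullet> grad \<theta>' z) / (\<theta> z * \<theta>' z) - (grad \<theta>' z \<bullet> grad \<theta>' z) / (\<theta>' z)\<^sup>2"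
    by (simp add: inner_diff_left power2_eq_square divide_inverse algebra_simps)
  have algebra: "(T - T' + (M - M')) - ((\<kappa> / t) * (G - X) - (\<kappa>' / t') * (X - G')
        + (t - t') * (A / t - \<kappa> * G / t\<^sup>2 - A' / t' + \<kappa>' * G' / t'\<^sup>2))
      + (t' / t\<^sup>2 * W - 1 / t * W' + (1 - t' / t) * (C - T - M))
      + (t - t') / t * (A - C + M) - (M - M') - (t - t') / t' * A'
      + t' * \<kappa> * (G / t\<^sup>2 - 2 * X / (t * t') + G' / t'\<^sup>2) - t' / t * (T + 1 / t * W)
    = - T' - (X / (t * t') - G' / t'\<^sup>2) * (t' * \<kappa> - t * \<kappa>') - 1 / t * W'"
    if "t > 0" "t' > 0" for t t' \<kappa> \<kappa>' T T' M M' G X G' A A' C W W' :: real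
    using that by (simp add: field_simps power2_eq_square)
  show ?thesis
    unfolding diffusive_flux_divergence heat_flux_divergence enthalpy_flux_divergence
      V[symmetric] s[symmetric] sums norm_sq inner
    by (rule algebra[OF pos])
qed

end

section \<open>The convective terms\<close>

lemma material_derivative_change:
  fixes f :: "spacetime \<Rightarrow> real"
  assumes "f differentiable (at z)"
  shows "frechet_derivative f (at z) (1, v) = frechet_derivative f (at z) (1, v') + (v - v') \<bullet> grad f z"
  using material_derivative[OF assms, of v] material_derivative[OF assms, of v']
  by (simp add: inner_diff_left)

text \<open>Along the reference flow densities change only by compression, and entropy only by
  compression and heat conduction. Expressing the material derivatives of \<open>\<mu>\<^sub>i'\<close> and \<open>\<theta>'\<close> in these terms
  produces exactly the linear parts of the Taylor expansions of \<open>-\<rho>\<eta>\<close> and of \<open>p\<close> at the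
  reference state.\<close>

lemma reference_remainders:
  fixes \<rho>' :: "spacetime \<Rightarrow> real^'n::finite" and F :: "'n state \<Rightarrow> real" and \<omega> :: "'n state"
  assumes op: "open D" and z: "z \<in> D" and F: "smooth_on F states" and fields: "smooth_fields D \<rho>' v' \<theta>'"
    and mass: "\<And>i. frechet_derivative (\<lambda>y. \<rho>' y $ i) (at z) (1, v' z) = - \<rho>' z $ i * divg v' z"
    and entropy: "\<theta>' z * (frechet_derivative (\<lambda>y. entropy_dens F (\<rho>' y, \<theta>' y)) (at z) (1, v' z)
      + entropy_dens F (\<rho>' z, \<theta>' z) * divg v' z) = r"
  shows "- (\<Sum>i\<in>UNIV. (fst \<omega> $ i - \<rho>' z $ i)
        * frechet_derivative (\<lambda>y. chem_pot F i (\<rho>' y, \<theta>' y)) (at z) (1, v' z))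
      - (entropy_dens F \<omega> - entropy_dens F (\<rho>' z, \<theta>' z)) * frechet_derivative \<theta>' (at z) (1, v' z)
    = frechet_derivative \<theta>' (at z) (1, v' z) * rel_neg_entropy F \<omega> (\<rho>' z, \<theta>' z)
      - rel_pressure F \<omega> (\<rho>' z, \<theta>' z) * divg v' z
      + (pressure F \<omega> - pressure F (\<rho>' z, \<theta>' z)) * divg v' z
      - (snd \<omega> - \<theta>' z) / \<theta>' z * r"
proof -
  let ?\<omega> = "(\<rho>' z, \<theta>' z)"
  define d where "d = divg v' z"
  define \<tau> where "\<tau> = frechet_derivative \<theta>' (at z) (1, v' z)"
  have st: "?\<omega> \<in> states"
    by (rule state_in_states[OF op z F fields])
  have "\<theta>' z > 0"
    using state_positive[OF st] by simp
  have \<mu>: "frechet_derivative (\<lambda>y. chem_pot F i (\<rho>' y, \<theta>' y)) (at z) (1, v' z)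
      = - d * d_rho i (pressure F) ?\<omega> - d_rho i (entropy_dens F) ?\<omega> * \<tau>" for i
    using chain_rule[OF op z F fields smooth_on_chem_pot[OF F, of i], of "(1, v' z)"]
    by (simp add: mass pressure_d_rho[OF F st] maxwell_entropy[OF F st] d_def \<tau>_def sum_distrib_left
        sum_negf algebra_simps)
  have "frechet_derivative (\<lambda>y. entropy_dens F (\<rho>' y, \<theta>' y)) (at z) (1, v' z)
      = - d * (\<Sum>j\<in>UNIV. d_rho j (entropy_dens F) ?\<omega> * \<rho>' z $ j) + d_theta (entropy_dens F) ?\<omega> * \<tau>"
    using chain_rule[OF op z F fields smooth_on_entropy_dens[OF F], of "(1, v' z)"]
    by (simp add: mass d_def \<tau>_def sum_distrib_left sum_negf algebra_simps)
  then have "frechet_derivative (\<lambda>y. entropy_dens F (\<rho>' y, \<theta>' y)) (at z) (1, v' z) + entropy_dens F ?\<omega> * d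
      = d * d_theta (pressure F) ?\<omega> + d_theta (entropy_dens F) ?\<omega> * \<tau>"
    by (simp add: pressure_d_theta[OF F st] algebra_simps)
  then have \<theta>: "d * d_theta (pressure F) ?\<omega> + d_theta (entropy_dens F) ?\<omega> * \<tau> = r / \<theta>' z"
    using entropy \<open>\<theta>' z > 0\<close> by (simp add: d_def[symmetric] field_simps)
  have "(snd \<omega> - \<theta>' z) / \<theta>' z * r = (snd \<omega> - \<theta>' z) * (d * d_theta (pressure F) ?\<omega> + d_theta (entropy_dens F) ?\<omega> * \<tau>)"
    by (simp add: \<theta>)
  then show ?thesis
    unfolding \<mu> rel_neg_entropy_def rel_pressure_def d_def[symmetric] \<tau>_def[symmetric] fst_conv snd_conv
    by (simp add: algebra_simps sum.distrib sum_subtractf sum_negf sum_distrib_left)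
qed

text \<open>Each term of the relative energy is differentiated along \<open>v\<close>. The kinetic part gives the
  pressure gradients by the two velocity equations, the internal part and the part \<open>-\<theta>' \<rho>\<eta>\<close> combine
  into \<open>\<theta> - \<theta>'\<close> times the entropy production, and the remaining parts only involve derivatives of the
  reference state. The latter are split into derivatives along \<open>v'\<close>, which
  \<open>reference_remainders\<close> evaluates, and gradients tested with \<open>w = v - v'\<close>.\<close>

lemma relative_energy_balance:
  fixes \<rho> \<rho>' :: "spacetime \<Rightarrow> real^'n::finite" and F :: "'n state \<Rightarrow> real"
  assumes op: "open D" and z: "z \<in> D" and F: "smooth_on F states"
    and fields: "smooth_fields D \<rho> v \<theta>" and fields': "smooth_fields D \<rho>' v' \<theta>'"
    and mass: "\<And>i. frechet_derivative (\<lambda>y. \<rho> y $ i) (at z) (1, v z) = - \<rho> z $ i * divg v z - s i"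
    and total_mass: "frechet_derivative (\<lambda>y. total_mass (\<rho> y, \<theta> y)) (at z) (1, v z)
      = - total_mass (\<rho> z, \<theta> z) * divg v z"
    and velocity: "\<And>\<beta>. total_mass (\<rho> z, \<theta> z) * frechet_derivative (\<lambda>y. v y $ \<beta>) (at z) (1, v z)
      = - grad (\<lambda>y. pressure F (\<rho> y, \<theta> y)) z $ \<beta>"
    and entropy: "\<theta> z * (frechet_derivative (\<lambda>y. entropy_dens F (\<rho> y, \<theta> y)) (at z) (1, v z)
      + entropy_dens F (\<rho> z, \<theta> z) * divg v z) = r + (\<Sum>i\<in>UNIV. chem_pot F i (\<rho> z, \<theta> z) * s i)"
    and mass': "\<And>i. frechet_derivative (\<lambda>y. \<rho>' y $ i) (at z) (1, v' z) = - \<rho>' z $ i * divg v' z"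
    and velocity': "\<And>\<beta>. total_mass (\<rho>' z, \<theta>' z) * frechet_derivative (\<lambda>y. v' y $ \<beta>) (at z) (1, v' z)
      = - grad (\<lambda>y. pressure F (\<rho>' y, \<theta>' y)) z $ \<beta>"
    and entropy': "\<theta>' z * (frechet_derivative (\<lambda>y. entropy_dens F (\<rho>' y, \<theta>' y)) (at z) (1, v' z)
      + entropy_dens F (\<rho>' z, \<theta>' z) * divg v' z) = r'"
  defines "I \<equiv> \<lambda>y. rel_energy F (\<rho> y, \<theta> y) (v y) (\<rho>' y, \<theta>' y) (v' y)"
    and "p \<equiv> \<lambda>y. pressure F (\<rho> y, \<theta> y)" and "p' \<equiv> \<lambda>y. pressure F (\<rho>' y, \<theta>' y)"
    and "\<mu> \<equiv> \<lambda>i y. chem_pot F i (\<rho> y, \<theta> y)" and "\<mu>' \<equiv> \<lambda>i y. chem_pot F i (\<rho>' y, \<theta>' y)"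
    and "m \<equiv> total_mass (\<rho> z, \<theta> z)" and "m' \<equiv> total_mass (\<rho>' z, \<theta>' z)"
    and "w \<equiv> v z - v' z"
  shows "I differentiable (at z)"
    and "frechet_derivative I (at z) (1, v z) + I z * divg v z
    = frechet_derivative \<theta>' (at z) (1, v' z) * rel_neg_entropy F (\<rho> z, \<theta> z) (\<rho>' z, \<theta>' z)
      - rel_pressure F (\<rho> z, \<theta> z) (\<rho>' z, \<theta>' z) * divg v' z
      - w \<bullet> (grad p z - grad p' z) - (p z - p' z) * (divg v z - divg v' z)
      + (\<theta> z - \<theta>' z) / \<theta> z * (r + (\<Sum>i\<in>UNIV. \<mu> i z * s i))
      - (\<Sum>i\<in>UNIV. (\<mu> i z - \<mu>' i z) * s i) - (\<theta> z - \<theta>' z) / \<theta>' z * r'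
      - (entropy F (\<rho> z, \<theta> z) - entropy F (\<rho>' z, \<theta>' z)) * m * (w \<bullet> grad \<theta>' z)
      - (\<Sum>i\<in>UNIV. (\<rho> z $ i / m - \<rho>' z $ i / m') * (grad (\<mu>' i) z \<bullet> (m *\<^sub>R w)))
      - m * grad_quad w v' z"
proof -
  define M where "M = (\<lambda>y. total_mass (\<rho> y, \<theta> y))"
  define E where "E = (\<lambda>y. energy_dens F (\<rho> y, \<theta> y))"
  define H where "H = (\<lambda>y. entropy_dens F (\<rho> y, \<theta> y))"
  define H' where "H' = (\<lambda>y. entropy_dens F (\<rho>' y, \<theta>' y))"
  define Dt where "Dt f = frechet_derivative f (at z) (1, v z)" for f :: "spacetime \<Rightarrow> real"
  define Dt' where "Dt' f = frechet_derivative f (at z) (1, v' z)" for f :: "spacetime \<Rightarrow> real"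
  define \<delta> where "\<delta> = divg v z"
  define Q where "Q = grad_quad w v' z"

  note diff0 = differentiable_fields[OF op z F fields] differentiable_total_mass[OF op z F fields]
    differentiable_state_function[OF op z F fields smooth_on_pressure[OF F]]
    differentiable_state_function[OF op z F fields smooth_on_energy_dens[OF F]]
    differentiable_state_function[OF op z F fields smooth_on_entropy_dens[OF F]]
    differentiable_fields[OF op z F fields']
    differentiable_state_function[OF op z F fields' smooth_on_pressure[OF F]]
    differentiable_state_function[OF op z F fields' smooth_on_entropy_dens[OF F]]
  have \<mu>'_diff: "\<mu>' i differentiable (at z)" for i
    unfolding \<mu>'_def by (rule differentiable_state_function[OF op z F fields' smooth_on_chem_pot[OF F]])
  note diff = \<mu>'_diff diff0[folded M_def p_def E_def H_def p'_def H'_def]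
  have pos: "\<theta> z > 0" "m > 0" "m' > 0"
    using state_positive[OF state_in_states[OF op z F fields]]
      state_positive[OF state_in_states[OF op z F fields']] by (simp_all add: m_def m'_def)
  have m: "m = M z"
    by (simp add: m_def M_def)

  (* The terms of I that involve the reference state alone add up to the reference pressure. *)
  have I_eq: "I = (\<lambda>y. 1/2 * (M y * (\<Sum>\<beta>\<in>UNIV. (v y $ \<beta> - v' y $ \<beta>) * (v y $ \<beta> - v' y $ \<beta>))) + E y
      - (\<Sum>i\<in>UNIV. \<mu>' i y * \<rho> y $ i) - \<theta>' y * H y + p' y)"
    unfolding I_def rel_energy_def M_def E_def H_def \<mu>'_def p'_def power2_norm_eq_inner inner_vec_def
    by (simp add: fun_eq_iff algebra_simps sum_subtractf energy_dens_def pressure_def)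
  show I_diff: "I differentiable (at z)"
    unfolding I_eq using diff by (auto intro!: derivative_intros)
  have w: "w $ \<beta> = v z $ \<beta> - v' z $ \<beta>" for \<beta>
    by (simp add: w_def)
  have Dt_I: "Dt I = 1/2 * (Dt M * (\<Sum>\<beta>\<in>UNIV. w $ \<beta> * w $ \<beta>)
        + M z * (\<Sum>\<beta>\<in>UNIV. (Dt (\<lambda>y. v y $ \<beta>) - Dt (\<lambda>y. v' y $ \<beta>)) * w $ \<beta>
            + w $ \<beta> * (Dt (\<lambda>y. v y $ \<beta>) - Dt (\<lambda>y. v' y $ \<beta>))))
      + Dt E - (\<Sum>i\<in>UNIV. Dt (\<mu>' i) * \<rho> z $ i + \<mu>' i z * Dt (\<lambda>y. \<rho> y $ i))
      - (Dt \<theta>' * H z + \<theta>' z * Dt H) + Dt p'"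
    unfolding I_eq Dt_def w using diff
    by (simp add: frechet_add frechet_diff frechet_mult frechet_sum del: mult_numeral_1 times_divide_eq_left)
  have change: "Dt f = Dt' f + w \<bullet> grad f z" if "f differentiable (at z)" for f
    unfolding Dt_def Dt'_def w_def using that by (rule material_derivative_change)

  have kinetic: "M z * (\<Sum>\<beta>\<in>UNIV. w $ \<beta> * (Dt (\<lambda>y. v y $ \<beta>) - Dt (\<lambda>y. v' y $ \<beta>)))
      = - (w \<bullet> grad p z) + m / m' * (w \<bullet> grad p' z) - m * Q"
  proof -
    have a: "M z * Dt (\<lambda>y. v y $ \<beta>) = - grad p z $ \<beta>" for \<beta>
      using velocity by (simp add: M_def Dt_def p_def)
    have b: "M z * Dt (\<lambda>y. v' y $ \<beta>) = - m / m' * grad p' z $ \<beta> + m * (w \<bullet> grad (\<lambda>y. v' y $ \<beta>) z)" for \<beta>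
    proof -
      have "m' * Dt' (\<lambda>y. v' y $ \<beta>) = - grad p' z $ \<beta>"
        using velocity' by (simp add: m'_def Dt'_def p'_def)
      then have "Dt' (\<lambda>y. v' y $ \<beta>) = - grad p' z $ \<beta> / m'"
        using pos by (simp add: field_simps)
      then have Dt_v': "Dt (\<lambda>y. v' y $ \<beta>) = - grad p' z $ \<beta> / m' + w \<bullet> grad (\<lambda>y. v' y $ \<beta>) z"
        using change[of "\<lambda>y. v' y $ \<beta>"] diff by simp
      show ?thesis
        unfolding Dt_v' by (simp add: m algebra_simps)
    qed
    have "M z * (\<Sum>\<beta>\<in>UNIV. w $ \<beta> * (Dt (\<lambda>y. v y $ \<beta>) - Dt (\<lambda>y. v' y $ \<beta>)))
        = (\<Sum>\<beta>\<in>UNIV. w $ \<beta> * (M z * Dt (\<lambda>y. v y $ \<beta>) - M z * Dt (\<lambda>y. v' y $ \<beta>)))"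
      by (simp add: sum_distrib_left algebra_simps)
    also have "\<dots> = - (\<Sum>\<beta>\<in>UNIV. w $ \<beta> * grad p z $ \<beta>) + m / m' * (\<Sum>\<beta>\<in>UNIV. w $ \<beta> * grad p' z $ \<beta>)
        - m * (\<Sum>\<beta>\<in>UNIV. w $ \<beta> * (w \<bullet> grad (\<lambda>y. v' y $ \<beta>) z))"
      unfolding a b
      by (simp add: sum_distrib_left sum_negf[symmetric] sum.distrib[symmetric] sum_subtractf[symmetric] algebra_simps)
    finally show ?thesis
      by (simp add: inner_vec_def Q_def grad_quad_eq)
  qed

  have internal: "Dt E + E z * \<delta> = - p z * \<delta> - (\<Sum>i\<in>UNIV. \<mu> i z * s i) + \<theta> z * (Dt H + H z * \<delta>)"
  proof -
    have "Dt E = (\<Sum>i\<in>UNIV. \<mu> i z * (- \<rho> z $ i * \<delta> - s i)) + \<theta> z * Dt H"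
      using gibbs_energy_flow[OF op z F fields, of "(1, v z)"]
      by (simp add: Dt_def E_def H_def \<mu>_def \<delta>_def mass)
    moreover have E_z: "E z = (\<Sum>i\<in>UNIV. \<rho> z $ i * \<mu> i z) + \<theta> z * H z - p z"
      using euler_relation[of F "\<rho> z" "\<theta> z"] by (simp add: E_def p_def H_def \<mu>_def)
    have "E z * \<delta> = (\<Sum>i\<in>UNIV. \<rho> z $ i * \<mu> i z) * \<delta> + \<theta> z * H z * \<delta> - p z * \<delta>"
      unfolding E_z by (simp add: algebra_simps)
    ultimately show ?thesis
      by (simp add: algebra_simps sum_subtractf sum_negf sum_distrib_left sum_distrib_right)
  qed

  have Dt_\<rho>: "Dt (\<lambda>y. \<rho> y $ i) = - \<rho> z $ i * \<delta> - s i" for i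
    using mass by (simp add: Dt_def \<delta>_def)
  have Dt_M: "Dt M = - M z * \<delta>"
    using total_mass by (simp add: Dt_def \<delta>_def M_def)
  define X where "X = Dt H + H z * \<delta>"
  have X: "X = (r + (\<Sum>i\<in>UNIV. \<mu> i z * s i)) / \<theta> z"
    using entropy pos by (simp add: X_def Dt_def H_def \<delta>_def \<mu>_def field_simps)

  have "Dt I + I z * \<delta> = - (w \<bullet> grad p z) + m / m' * (w \<bullet> grad p' z) - m * Q - p z * \<delta>
      - (\<Sum>i\<in>UNIV. (\<mu> i z - \<mu>' i z) * s i) + (\<theta> z - \<theta>' z) * X
      - (\<Sum>i\<in>UNIV. \<rho> z $ i * Dt (\<mu>' i)) - H z * Dt \<theta>' + Dt p' + p' z * \<delta>"
  proof -
    have double: "(\<Sum>\<beta>\<in>UNIV. (Dt (\<lambda>y. v y $ \<beta>) - Dt (\<lambda>y. v' y $ \<beta>)) * w $ \<beta>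
          + w $ \<beta> * (Dt (\<lambda>y. v y $ \<beta>) - Dt (\<lambda>y. v' y $ \<beta>)))
        = 2 * (\<Sum>\<beta>\<in>UNIV. w $ \<beta> * (Dt (\<lambda>y. v y $ \<beta>) - Dt (\<lambda>y. v' y $ \<beta>)))"
      unfolding sum_distrib_left by (intro sum.cong refl) (simp add: algebra_simps)
    define S where "S = (\<Sum>\<beta>\<in>UNIV. w $ \<beta> * w $ \<beta>)"
    have "Dt I = - 1/2 * M z * \<delta> * S + (- (w \<bullet> grad p z) + m / m' * (w \<bullet> grad p' z) - m * Q)
        + Dt E - (\<Sum>i\<in>UNIV. \<rho> z $ i * Dt (\<mu>' i)) + (\<Sum>i\<in>UNIV. \<mu>' i z * \<rho> z $ i) * \<delta>
        + (\<Sum>i\<in>UNIV. \<mu>' i z * s i) - (Dt \<theta>' * H z + \<theta>' z * Dt H) + Dt p'"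
      unfolding Dt_I kinetic[symmetric] double Dt_M Dt_\<rho> S_def
      by (simp add: algebra_simps sum.distrib sum_subtractf sum_negf sum_distrib_left sum_distrib_right
          flip: sum_distrib_left)
    moreover have "I z * \<delta> = 1/2 * M z * \<delta> * S + E z * \<delta> - (\<Sum>i\<in>UNIV. \<mu>' i z * \<rho> z $ i) * \<delta>
        - \<theta>' z * H z * \<delta> + p' z * \<delta>"
      unfolding I_eq S_def w by (simp add: left_diff_distrib distrib_right)
    moreover have "(\<Sum>i\<in>UNIV. (\<mu> i z - \<mu>' i z) * s i) = (\<Sum>i\<in>UNIV. \<mu> i z * s i) - (\<Sum>i\<in>UNIV. \<mu>' i z * s i)"
      by (simp add: left_diff_distrib sum_subtractf)
    ultimately show ?thesis
      using internal unfolding X_def by (simp add: algebra_simps)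
  qed
  also have "\<dots> = - (w \<bullet> grad p z) + m / m' * (w \<bullet> grad p' z) - m * Q - p z * \<delta>
      - (\<Sum>i\<in>UNIV. (\<mu> i z - \<mu>' i z) * s i) + (\<theta> z - \<theta>' z) * X
      + (- (\<Sum>i\<in>UNIV. (\<rho> z $ i - \<rho>' z $ i) * Dt' (\<mu>' i)) - (H z - H' z) * Dt' \<theta>')
      - (\<Sum>i\<in>UNIV. \<rho> z $ i * (w \<bullet> grad (\<mu>' i) z)) - H z * (w \<bullet> grad \<theta>' z)
      + w \<bullet> grad p' z + p' z * \<delta>"
  proof -
    have "Dt' p' = (\<Sum>i\<in>UNIV. \<rho>' z $ i * Dt' (\<mu>' i)) + H' z * Dt' \<theta>'"
      using gibbs_duhem_flow[OF op z F fields', of "(1, v' z)"]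
      by (simp add: Dt'_def p'_def \<mu>'_def H'_def)
    then show ?thesis
      using diff by (simp add: change algebra_simps sum.distrib sum_subtractf)
  qed
  also have "- (\<Sum>i\<in>UNIV. (\<rho> z $ i - \<rho>' z $ i) * Dt' (\<mu>' i)) - (H z - H' z) * Dt' \<theta>'
      = Dt' \<theta>' * rel_neg_entropy F (\<rho> z, \<theta> z) (\<rho>' z, \<theta>' z)
        - rel_pressure F (\<rho> z, \<theta> z) (\<rho>' z, \<theta>' z) * divg v' z
        + (p z - p' z) * divg v' z - (\<theta> z - \<theta>' z) / \<theta>' z * r'"
    using reference_remainders[OF op z F fields' mass' entropy', of "(\<rho> z, \<theta> z)"]
    by (simp add: Dt'_def p_def p'_def H_def H'_def \<mu>'_def)
  also have "- (w \<bullet> grad p z) + m / m' * (w \<bullet> grad p' z) - m * Q - p z * \<delta>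
      - (\<Sum>i\<in>UNIV. (\<mu> i z - \<mu>' i z) * s i) + (\<theta> z - \<theta>' z) * X
      + (Dt' \<theta>' * rel_neg_entropy F (\<rho> z, \<theta> z) (\<rho>' z, \<theta>' z)
        - rel_pressure F (\<rho> z, \<theta> z) (\<rho>' z, \<theta>' z) * divg v' z
        + (p z - p' z) * divg v' z - (\<theta> z - \<theta>' z) / \<theta>' z * r')
      - (\<Sum>i\<in>UNIV. \<rho> z $ i * (w \<bullet> grad (\<mu>' i) z)) - H z * (w \<bullet> grad \<theta>' z)
      + w \<bullet> grad p' z + p' z * \<delta>
    = Dt' \<theta>' * rel_neg_entropy F (\<rho> z, \<theta> z) (\<rho>' z, \<theta>' z)
      - rel_pressure F (\<rho> z, \<theta> z) (\<rho>' z, \<theta>' z) * divg v' z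
      - w \<bullet> (grad p z - grad p' z) - (p z - p' z) * (\<delta> - divg v' z)
      + (\<theta> z - \<theta>' z) * X
      - (\<Sum>i\<in>UNIV. (\<mu> i z - \<mu>' i z) * s i) - (\<theta> z - \<theta>' z) / \<theta>' z * r'
      - (H z / m - H' z / m') * m * (w \<bullet> grad \<theta>' z)
      - (\<Sum>i\<in>UNIV. (\<rho> z $ i / m - \<rho>' z $ i / m') * (grad (\<mu>' i) z \<bullet> (m *\<^sub>R w)))
      - m * Q"
  proof -
    (* By the Gibbs-Duhem relation the reference pressure force, weighted with m/m', supplies the
       primed halves of the differences of mass fractions and specific entropies. *)
    have p': "w \<bullet> grad p' z = (\<Sum>i\<in>UNIV. \<rho>' z $ i * (w \<bullet> grad (\<mu>' i) z)) + H' z * (w \<bullet> grad \<theta>' z)"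
      using gibbs_duhem_flow[OF op z F fields', of "(0, w)"] diff
      by (simp add: grad_inner p'_def \<mu>'_def H'_def)
    have "m / m' * (w \<bullet> grad p' z) = (\<Sum>i\<in>UNIV. m * (\<rho>' z $ i / m') * (w \<bullet> grad (\<mu>' i) z))
        + m * (H' z / m') * (w \<bullet> grad \<theta>' z)"
      unfolding p' by (simp add: distrib_left sum_distrib_left algebra_simps)
    moreover have "(\<Sum>i\<in>UNIV. (\<rho> z $ i / m - \<rho>' z $ i / m') * (grad (\<mu>' i) z \<bullet> (m *\<^sub>R w)))
        = (\<Sum>i\<in>UNIV. \<rho> z $ i * (w \<bullet> grad (\<mu>' i) z))
          - (\<Sum>i\<in>UNIV. m * (\<rho>' z $ i / m') * (w \<bullet> grad (\<mu>' i) z))"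
      unfolding sum_subtractf[symmetric] using pos
      by (intro sum.cong) (auto simp: inner_commute left_diff_distrib)
    moreover have "(H z / m - H' z / m') * m = H z - m * (H' z / m')"
      using pos by (simp add: left_diff_distrib)
    ultimately show ?thesis
      by (simp add: inner_diff_right algebra_simps)
  qed
  finally show "frechet_derivative I (at z) (1, v z) + I z * divg v z
    = frechet_derivative \<theta>' (at z) (1, v' z) * rel_neg_entropy F (\<rho> z, \<theta> z) (\<rho>' z, \<theta>' z)
      - rel_pressure F (\<rho> z, \<theta> z) (\<rho>' z, \<theta>' z) * divg v' z
      - w \<bullet> (grad p z - grad p' z) - (p z - p' z) * (divg v z - divg v' z)
      + (\<theta> z - \<theta>' z) / \<theta> z * (r + (\<Sum>i\<in>UNIV. \<mu> i z * s i))
      - (\<Sum>i\<in>UNIV. (\<mu> i z - \<mu>' i z) * s i) - (\<theta> z - \<theta>' z) / \<theta>' z * r'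
      - (entropy F (\<rho> z, \<theta> z) - entropy F (\<rho>' z, \<theta>' z)) * m * (w \<bullet> grad \<theta>' z)
      - (\<Sum>i\<in>UNIV. (\<rho> z $ i / m - \<rho>' z $ i / m') * (grad (\<mu>' i) z \<bullet> (m *\<^sub>R w)))
      - m * grad_quad w v' z"
    unfolding Dt_def Dt'_def \<delta>_def Q_def X H_def H'_def entropy_def m_def[symmetric] m'_def[symmetric]
    by simp
qed

section \<open>The relative energy identity\<close>

theorem mainTheorem3:
  fixes D :: "spacetime set"
    and F :: "('n::finite) state \<Rightarrow> real"
    and e q :: "'n \<Rightarrow> 'n state \<Rightarrow> real"
    and \<kappa> :: "'n state \<Rightarrow> real"
    and b :: "'n \<Rightarrow> 'n \<Rightarrow> real \<times> real \<times> real \<Rightarrow> real"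
    and \<epsilon> :: real
    and \<rho> \<rho>' :: "spacetime \<Rightarrow> real^'n"
    and v v' :: "spacetime \<Rightarrow> real^3"
    and \<theta> \<theta>' :: "spacetime \<Rightarrow> real"
    and u :: "'n \<Rightarrow> spacetime \<Rightarrow> real^3"
  assumes "open D"
    and "constitutive F e q \<kappa> b"
    and "\<epsilon> > 0"
    and "diffusive_solution D F e q \<kappa> b \<epsilon> \<rho> v \<theta> u"
    and "nondiffusive_solution D F \<kappa> \<rho>' v' \<theta>'"
  shows
    "let \<omega> = (\<lambda>z. (\<rho> z, \<theta> z)); \<omega>' = (\<lambda>z. (\<rho>' z, \<theta>' z));
         m = (\<lambda>z. total_mass (\<omega> z)); m' = (\<lambda>z. total_mass (\<omega>' z));
         p = (\<lambda>z. pressure F (\<omega> z)); p' = (\<lambda>z. pressure F (\<omega>' z));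
         \<eta> = (\<lambda>z. entropy F (\<omega> z)); \<eta>' = (\<lambda>z. entropy F (\<omega>' z));
         \<mu> = (\<lambda>j z. chem_pot F j (\<omega> z)); \<mu>' = (\<lambda>j z. chem_pot F j (\<omega>' z));
         k = (\<lambda>z. \<kappa> (\<omega> z)); k' = (\<lambda>z. \<kappa> (\<omega>' z));
         h = (\<lambda>j z. enthalpy e q j (\<omega> z));
         d = driving_force F e q \<rho> \<theta>;
         I = (\<lambda>z. rel_energy F (\<omega> z) (v z) (\<omega>' z) (v' z))
     in \<forall>z\<in>D.
       dt I z
       + divg (\<lambda>y. I y *\<^sub>R v y + (p y - p' y) *\<^sub>R (v y - v' y)
                 + (\<Sum>j\<in>UNIV. (\<rho> y $ j * (\<mu> j y - \<mu>' j y)) *\<^sub>R u j y)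
                 - (\<theta> y - \<theta>' y) *\<^sub>R ((1 / \<theta> y * k y) *\<^sub>R grad \<theta> y - (1 / \<theta>' y * k' y) *\<^sub>R grad \<theta>' y)
                 + (1 / \<theta> y * (\<theta> y - \<theta>' y)) *\<^sub>R (\<Sum>j\<in>UNIV. (h j y - \<rho> y $ j * \<mu> j y) *\<^sub>R u j y)) z
       + \<theta>' z * k z * (norm (grad \<theta> z /\<^sub>R \<theta> z - grad \<theta>' z /\<^sub>R \<theta>' z))\<^sup>2
       - \<theta>' z / \<theta> z * (\<Sum>j\<in>UNIV. u j z \<bullet> d j z)
     = (dt \<theta>' z + v' z \<bullet> grad \<theta>' z) * rel_neg_entropy F (\<omega> z) (\<omega>' z)
       - rel_pressure F (\<omega> z) (\<omega>' z) * divg v' z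
       - (\<eta> z - \<eta>' z) * m z * ((v z - v' z) \<bullet> grad \<theta>' z)
       - (\<Sum>j\<in>UNIV. (\<rho> z $ j / m z - \<rho>' z $ j / m' z) * (grad (\<mu>' j) z \<bullet> (m z *\<^sub>R (v z - v' z))))
       - m z * grad_quad (v z - v' z) v' z
       - (\<Sum>j\<in>UNIV. grad (\<mu>' j) z \<bullet> ((\<rho> z $ j) *\<^sub>R u j z))
       - ((grad \<theta> z /\<^sub>R \<theta> z - grad \<theta>' z /\<^sub>R \<theta>' z) \<bullet> (grad \<theta>' z /\<^sub>R \<theta>' z)) * (\<theta>' z * k z - \<theta> z * k' z)
       - 1 / \<theta> z * (grad \<theta>' z \<bullet> (\<Sum>j\<in>UNIV. (h j z - \<rho> z $ j * \<mu> j z) *\<^sub>R u j z))"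
proof -
  define m m' where "m = (\<lambda>z. total_mass (\<rho> z, \<theta> z))" and "m' = (\<lambda>z. total_mass (\<rho>' z, \<theta>' z))"
  define p p' where "p = (\<lambda>z. pressure F (\<rho> z, \<theta> z))" and "p' = (\<lambda>z. pressure F (\<rho>' z, \<theta>' z))"
  define \<eta> \<eta>' where "\<eta> = (\<lambda>z. entropy F (\<rho> z, \<theta> z))" and "\<eta>' = (\<lambda>z. entropy F (\<rho>' z, \<theta>' z))"
  define \<mu> \<mu>' where "\<mu> = (\<lambda>j z. chem_pot F j (\<rho> z, \<theta> z))" and "\<mu>' = (\<lambda>j z. chem_pot F j (\<rho>' z, \<theta>' z))"
  define k k' where "k = (\<lambda>z. \<kappa> (\<rho> z, \<theta> z))" and "k' = (\<lambda>z. \<kappa> (\<rho>' z, \<theta>' z))"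
  define h where "h = (\<lambda>j z. enthalpy e q j (\<rho> z, \<theta> z))"
  define I where "I = (\<lambda>z. rel_energy F (\<rho> z, \<theta> z) (v z) (\<rho>' z, \<theta>' z) (v' z))"
  define V where "V = (\<lambda>z. \<Sum>j\<in>UNIV. (h j z - \<rho> z $ j * \<mu> j z) *\<^sub>R u j z)"
  note op = assms(1)
  have F: "smooth_on F states" and \<kappa>: "smooth_on \<kappa> states"
    and e: "\<And>i. smooth_on (e i) states" and q: "\<And>i. smooth_on (q i) states"
    using assms(2) by (simp_all add: constitutive_def)
  have fields: "smooth_fields D \<rho> v \<theta>"
    using assms(4) by (simp add: diffusive_solution_def)
  have fields': "smooth_fields D \<rho>' v' \<theta>'"
    using assms(5) by (simp add: nondiffusive_solution_def)
  have identity: "dt I z + divg (\<lambda>y. I y *\<^sub>R v y + (p y - p' y) *\<^sub>R (v y - v' y) + (\<Sum>j\<in>UNIV. (\<rho> y $ j * (\<mu> j y - \<mu>' j y)) *\<^sub>R u j y)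
         - (\<theta> y - \<theta>' y) *\<^sub>R ((1 / \<theta> y * k y) *\<^sub>R grad \<theta> y - (1 / \<theta>' y * k' y) *\<^sub>R grad \<theta>' y)
         + (1 / \<theta> y * (\<theta> y - \<theta>' y)) *\<^sub>R (\<Sum>j\<in>UNIV. (h j y - \<rho> y $ j * \<mu> j y) *\<^sub>R u j y)) z
       + \<theta>' z * k z * (norm (grad \<theta> z /\<^sub>R \<theta> z - grad \<theta>' z /\<^sub>R \<theta>' z))\<^sup>2
       - \<theta>' z / \<theta> z * (\<Sum>j\<in>UNIV. u j z \<bullet> driving_force F e q \<rho> \<theta> j z)
     = (dt \<theta>' z + v' z \<bullet> grad \<theta>' z) * rel_neg_entropy F (\<rho> z, \<theta> z) (\<rho>' z, \<theta>' z)
       - rel_pressure F (\<rho> z, \<theta> z) (\<rho>' z, \<theta>' z) * divg v' z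
       - (\<eta> z - \<eta>' z) * m z * ((v z - v' z) \<bullet> grad \<theta>' z)
       - (\<Sum>j\<in>UNIV. (\<rho> z $ j / m z - \<rho>' z $ j / m' z) * (grad (\<mu>' j) z \<bullet> (m z *\<^sub>R (v z - v' z))))
       - m z * grad_quad (v z - v' z) v' z
       - (\<Sum>j\<in>UNIV. grad (\<mu>' j) z \<bullet> ((\<rho> z $ j) *\<^sub>R u j z))
       - ((grad \<theta> z /\<^sub>R \<theta> z - grad \<theta>' z /\<^sub>R \<theta>' z) \<bullet> (grad \<theta>' z /\<^sub>R \<theta>' z)) * (\<theta>' z * k z - \<theta> z * k' z)
       - 1 / \<theta> z * (grad \<theta>' z \<bullet> V z)"
    if z: "z \<in> D" for z
  proof -
    note flow = assms(4)[unfolded diffusive_solution_def Let_def, THEN conjunct2, rule_format, OF z]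
    note flow' = assms(5)[unfolded nondiffusive_solution_def Let_def, THEN conjunct2, rule_format, OF z]
    define s where "s = (\<lambda>i. divg (\<lambda>y. (\<rho> y $ i) *\<^sub>R u i y) z)"
    define r where "r = divg (\<lambda>y. k y *\<^sub>R grad \<theta> y) z - divg (\<lambda>y. \<Sum>j\<in>UNIV. h j y *\<^sub>R u j y) z"
    define r' where "r' = divg (\<lambda>y. k' y *\<^sub>R grad \<theta>' y) z"

    have du: "u j differentiable (at z)" for j
      using diffusional_velocity_differentiable[OF op assms(2,4) z] .
    note df = differentiable_fields[OF op z F fields] and df' = differentiable_fields[OF op z F fields']
    note dsf = differentiable_state_function[OF op z F fields] and dsf' = differentiable_state_function[OF op z F fields']
    have grad_differentiable: "grad \<tau> differentiable (at z)" if "smooth_on \<tau> D" for \<tau>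
      by (rule differentiable_vecI)
        (simp add: grad_nth smooth_on_differentiable[OF smooth_on_dx[OF op that] z])
    have dgrad: "grad \<theta> differentiable (at z)" "grad \<theta>' differentiable (at z)"
      using grad_differentiable smooth_fieldsD[OF op fields] smooth_fieldsD[OF op fields'] by auto
    have dk: "k differentiable (at z)" "k' differentiable (at z)"
      unfolding k_def k'_def using dsf[OF \<kappa>] dsf'[OF \<kappa>] by auto
    have d\<mu>: "\<mu> j differentiable (at z)" "\<mu>' j differentiable (at z)" for j
      unfolding \<mu>_def \<mu>'_def using dsf[OF smooth_on_chem_pot[OF F]] dsf'[OF smooth_on_chem_pot[OF F]] by auto
    have dp: "p differentiable (at z)" "p' differentiable (at z)"
      unfolding p_def p'_def using dsf[OF smooth_on_pressure[OF F]] dsf'[OF smooth_on_pressure[OF F]] by auto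
    have dh: "h j differentiable (at z)" for j
      unfolding h_def enthalpy_def using df dsf[OF e] dsf[OF q] by simp
    have pos: "\<theta> z > 0" "\<theta>' z > 0"
      using state_positive[OF state_in_states[OF op z F fields]]
        state_positive[OF state_in_states[OF op z F fields']] by simp_all

    have constraint: "(\<Sum>i\<in>UNIV. (\<rho> y $ i) *\<^sub>R u i y) = 0" if "y \<in> D" for y
      using assms(4) that by (simp add: diffusive_solution_def Let_def)
    have "(\<Sum>i\<in>UNIV. s i) = divg (\<lambda>y. \<Sum>i\<in>UNIV. (\<rho> y $ i) *\<^sub>R u i y) z"
      unfolding s_def using df du by (intro divg_sum[symmetric]) simp_all
    also have "\<dots> = 0"
      by (rule divg_zero_on_open[OF op z constraint])
    finally have sum_s: "(\<Sum>i\<in>UNIV. s i) = 0" .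
    have mass: "dt (\<lambda>y. \<rho> y $ i) z + divg (\<lambda>y. (\<rho> y $ i) *\<^sub>R v y) z = - s i" for i
      using flow unfolding s_def by blast
    have mass': "dt (\<lambda>y. \<rho>' y $ i) z + divg (\<lambda>y. (\<rho>' y $ i) *\<^sub>R v' y) z = - 0" for i
      using flow' by simp
    have momentum: "dt (\<lambda>y. total_mass (\<rho> y, \<theta> y) *\<^sub>R v y) z
        + div_tensor (\<lambda>y. total_mass (\<rho> y, \<theta> y) *\<^sub>R outer (v y) (v y) + pressure F (\<rho> y, \<theta> y) *\<^sub>R mat 1) z = 0"
      using flow by blast
    have momentum': "dt (\<lambda>y. total_mass (\<rho>' y, \<theta>' y) *\<^sub>R v' y) z
        + div_tensor (\<lambda>y. total_mass (\<rho>' y, \<theta>' y) *\<^sub>R outer (v' y) (v' y) + pressure F (\<rho>' y, \<theta>' y) *\<^sub>R mat 1) z = 0"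
      using flow' by blast
    have "divg (\<lambda>y. k y *\<^sub>R grad \<theta> y - (\<Sum>j\<in>UNIV. h j y *\<^sub>R u j y)) z = r"
      unfolding r_def using dk dgrad dh du by (intro divg_diff) simp_all
    then have energy: "dt (\<lambda>y. energy_dens F (\<rho> y, \<theta> y) + 1/2 * total_mass (\<rho> y, \<theta> y) * (norm (v y))\<^sup>2) z
        + divg (\<lambda>y. (energy_dens F (\<rho> y, \<theta> y) + 1/2 * total_mass (\<rho> y, \<theta> y) * (norm (v y))\<^sup>2) *\<^sub>R v y
                  + pressure F (\<rho> y, \<theta> y) *\<^sub>R v y) z = r"
      using flow unfolding k_def h_def by metis
    have energy': "dt (\<lambda>y. energy_dens F (\<rho>' y, \<theta>' y) + 1/2 * total_mass (\<rho>' y, \<theta>' y) * (norm (v' y))\<^sup>2) z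
        + divg (\<lambda>y. (energy_dens F (\<rho>' y, \<theta>' y) + 1/2 * total_mass (\<rho>' y, \<theta>' y) * (norm (v' y))\<^sup>2) *\<^sub>R v' y
                  + pressure F (\<rho>' y, \<theta>' y) *\<^sub>R v' y) z = r'"
      using flow' unfolding r'_def k'_def by blast

    note laws = op z F fields mass sum_s momentum energy
    have sum_0: "(\<Sum>i\<in>(UNIV::'n set). (0::real)) = 0"
      by simp
    note laws' = op z F fields' mass' sum_0 momentum' energy'
    have mass_c': "frechet_derivative (\<lambda>y. \<rho>' y $ i) (at z) (1, v' z) = - \<rho>' z $ i * divg v' z" for i
      using mass_convective[OF laws'] by simp
    have entropy_c': "\<theta>' z * (frechet_derivative (\<lambda>y. entropy_dens F (\<rho>' y, \<theta>' y)) (at z) (1, v' z)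
        + entropy_dens F (\<rho>' z, \<theta>' z) * divg v' z) = r'"
      using entropy_convective[OF laws'] by simp
    note balance = relative_energy_balance[OF op z F fields fields' mass_convective[OF laws]
        total_mass_convective[OF laws] velocity_convective[OF laws] entropy_convective[OF laws]
        mass_c' velocity_convective[OF laws'] entropy_c']
    have dI: "I differentiable (at z)"
      unfolding I_def by (rule balance(1))
    have convective: "frechet_derivative I (at z) (1, v z) + I z * divg v z
      = frechet_derivative \<theta>' (at z) (1, v' z) * rel_neg_entropy F (\<rho> z, \<theta> z) (\<rho>' z, \<theta>' z)
        - rel_pressure F (\<rho> z, \<theta> z) (\<rho>' z, \<theta>' z) * divg v' z
        - (v z - v' z) \<bullet> (grad p z - grad p' z) - (p z - p' z) * (divg v z - divg v' z)
        + (\<theta> z - \<theta>' z) / \<theta> z * (r + (\<Sum>i\<in>UNIV. \<mu> i z * s i))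
        - (\<Sum>i\<in>UNIV. (\<mu> i z - \<mu>' i z) * s i) - (\<theta> z - \<theta>' z) / \<theta>' z * r'
        - (\<eta> z - \<eta>' z) * m z * ((v z - v' z) \<bullet> grad \<theta>' z)
        - (\<Sum>i\<in>UNIV. (\<rho> z $ i / m z - \<rho>' z $ i / m' z) * (grad (\<mu>' i) z \<bullet> (m z *\<^sub>R (v z - v' z))))
        - m z * grad_quad (v z - v' z) v' z"
      unfolding I_def p_def p'_def \<mu>_def \<mu>'_def m_def m'_def \<eta>_def \<eta>'_def by (rule balance(2))

    let ?f1 = "\<lambda>y. \<Sum>j\<in>UNIV. (\<rho> y $ j * (\<mu> j y - \<mu>' j y)) *\<^sub>R u j y"
    let ?f2 = "\<lambda>y. (\<theta> y - \<theta>' y) *\<^sub>R ((1 / \<theta> y * k y) *\<^sub>R grad \<theta> y - (1 / \<theta>' y * k' y) *\<^sub>R grad \<theta>' y)"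
    let ?f3 = "\<lambda>y. (1 / \<theta> y * (\<theta> y - \<theta>' y)) *\<^sub>R (\<Sum>j\<in>UNIV. (h j y - \<rho> y $ j * \<mu> j y) *\<^sub>R u j y)"
    have df1: "?f1 differentiable (at z)"
      using df d\<mu> du by simp
    have df2: "?f2 differentiable (at z)"
      using df df' dk dgrad pos
      by (auto intro!: differentiable_scaleR differentiable_mult differentiable_divide differentiable_diff)
    have df3: "?f3 differentiable (at z)"
      using df df' d\<mu> dh du pos
      by (auto intro!: differentiable_scaleR differentiable_mult differentiable_divide differentiable_diff
          differentiable_sum)
    have dIv: "(\<lambda>y. I y *\<^sub>R v y) differentiable (at z)" "(\<lambda>y. (p y - p' y) *\<^sub>R (v y - v' y)) differentiable (at z)"
      using dI dp df df' by (auto intro!: differentiable_scaleR differentiable_diff)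
    have "divg (\<lambda>y. I y *\<^sub>R v y + (p y - p' y) *\<^sub>R (v y - v' y) + ?f1 y - ?f2 y + ?f3 y) z
        = divg (\<lambda>y. I y *\<^sub>R v y) z + divg (\<lambda>y. (p y - p' y) *\<^sub>R (v y - v' y)) z + divg ?f1 z - divg ?f2 z + divg ?f3 z"
      using dIv df1 df2 df3
      by (simp only: divg_add divg_diff differentiable_add differentiable_diff)
    also have "divg (\<lambda>y. I y *\<^sub>R v y) z = v z \<bullet> grad I z + I z * divg v z"
      using dI df by (simp add: divg_scaleR)
    also have "divg (\<lambda>y. (p y - p' y) *\<^sub>R (v y - v' y)) z
        = (v z - v' z) \<bullet> (grad p z - grad p' z) + (p z - p' z) * (divg v z - divg v' z)"
      using dp df df' by (simp add: divg_scaleR divg_diff grad_diff)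
    finally have flux: "dt I z + divg (\<lambda>y. I y *\<^sub>R v y + (p y - p' y) *\<^sub>R (v y - v' y) + ?f1 y - ?f2 y + ?f3 y) z
        = (frechet_derivative I (at z) (1, v z) + I z * divg v z)
          + ((v z - v' z) \<bullet> (grad p z - grad p' z) + (p z - p' z) * (divg v z - divg v' z))
          + divg ?f1 z - divg ?f2 z + divg ?f3 z"
      using material_derivative[OF dI, of "v z"] by linarith

    note diffs = df(1) d\<mu> dh du df(3) df'(3) dk dgrad pos constraint[OF z]
    note balance_diffusive = diffusive_identity[where \<rho> = "\<lambda>j y. \<rho> y $ j", OF diffs refl, of s]
    have diffusive: "divg ?f1 z - divg ?f2 z + divg ?f3 z
      + (\<theta> z - \<theta>' z) / \<theta> z * (r + (\<Sum>i\<in>UNIV. \<mu> i z * s i))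
      - (\<Sum>i\<in>UNIV. (\<mu> i z - \<mu>' i z) * s i) - (\<theta> z - \<theta>' z) / \<theta>' z * r'
      + \<theta>' z * k z * (norm (grad \<theta> z /\<^sub>R \<theta> z - grad \<theta>' z /\<^sub>R \<theta>' z))\<^sup>2
      - \<theta>' z / \<theta> z * ((\<Sum>j\<in>UNIV. \<rho> z $ j * (u j z \<bullet> grad (\<mu> j) z)) + 1 / \<theta> z * (V z \<bullet> grad \<theta> z))
      = - (\<Sum>j\<in>UNIV. \<rho> z $ j * (u j z \<bullet> grad (\<mu>' j) z))
        - ((grad \<theta> z /\<^sub>R \<theta> z - grad \<theta>' z /\<^sub>R \<theta>' z) \<bullet> (grad \<theta>' z /\<^sub>R \<theta>' z)) * (\<theta>' z * k z - \<theta> z * k' z)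
        - 1 / \<theta> z * (V z \<bullet> grad \<theta>' z)"
      using balance_diffusive unfolding r_def r'_def s_def V_def by simp
    have dissipation: "(\<Sum>j\<in>UNIV. u j z \<bullet> driving_force F e q \<rho> \<theta> j z)
        = (\<Sum>j\<in>UNIV. \<rho> z $ j * (u j z \<bullet> grad (\<mu> j) z)) + 1 / \<theta> z * (V z \<bullet> grad \<theta> z)"
      using diffusive_dissipation[where \<rho> = "\<lambda>j y. \<rho> y $ j", OF diffs, of "m z" "grad p z"]
      unfolding driving_force_def V_def p_def m_def h_def \<mu>_def .
    have cross: "(\<Sum>j\<in>UNIV. grad (\<mu>' j) z \<bullet> ((\<rho> z $ j) *\<^sub>R u j z)) = (\<Sum>j\<in>UNIV. \<rho> z $ j * (u j z \<bullet> grad (\<mu>' j) z))"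
      by (simp add: inner_commute)

    show ?thesis
      unfolding flux convective dissipation cross material_derivative[OF df'(3)] inner_commute[of "grad \<theta>' z" "V z"]
      using diffusive by argo
  qed
  show ?thesis
    unfolding Let_def
    using identity unfolding I_def p_def p'_def \<eta>_def \<eta>'_def \<mu>_def \<mu>'_def k_def k'_def h_def m_def m'_def V_def
    by (rule ballI)
qed

end
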